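(* Let $\mathcal{A}=\mathcal{A}_1\cup\mathcal{A}_2\cup\mathcal{A}_3$ be an arrangement of $9$ lines in $\mathbb{P}^2\mathbb{C}$ defined by a $(3,3)$-net. Then every intersection point of $\mathcal{A}$ is a double or a triple point. The $9$ mixed triple points are always triple points. Moreover, the number of non-mixed triple points (each lying inside a single class $\mathcal{A}_i$) is $0$, $1$ or $3$; in particular, no such net has exactly $11$ triple points. More precisely, exactly one of the following holds. (1) $\mathcal{A}$ has no double points and $12$ triple points: the $9$ mixed ones and one triple point inside each $\mathcal{A}_i$. In this case $\mathcal{A}$ is lattice isomorphic to the Ceva arrangement $(x^3-y^3)(y^3-z^3)(z^3-x^3)=0$. (2) $\mathcal{A}$ has $9$ double points, and its only triple points are the $9$ mixed triple points. In this case $\mathcal{A}$ is lattice isomorphic to the Hesse-type arrangement obtained as the union of three of the four singular fibers of the Hesse pencil $a(x^3+y^3+z^3)+b\,xyz$; each singular fiber is a union of three lines. (3) $\mathcal{A}$ has $6$ double points and $10$ triple points: the $9$ mixed ones and one triple point inside exactly one of the $\mathcal{A}_i$. In this case $\mathcal{A}$ is lattice isomorphic to the arrangement with lines $L_1=(y)$, $L_2=(\tfrac1b x+y+z)$, $L_3=(\tfrac{b}{b-1}x+z)$, $L_4=(x)$, $L_5=(x+by+z)$, $L_6=(by+z)$, $L_7=(x+b(1-b)y)$, $L_8=(x+y+z)$, $L_9=(z)$, for some $b\in\mathbb{C}\setminus\{0,1\}$ with $b^3\neq -1$. All three cases occur.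
   Context: A $(3,q)$-net in $\mathbb{P}^2\mathbb{C}$ is a line arrangement $\mathcal{A}$ together with a partition $\mathcal{A}=\mathcal{A}_1\sqcup\mathcal{A}_2\sqcup\mathcal{A}_3$ with $|\mathcal{A}_i|=q$ for each $i$, such that every intersection point of two lines from different classes lies on exactly one line of each class. Equivalently, $\mathcal{A}$ is defined by $Q_1Q_2Q_3=0$ where $Q_1,Q_2$ span a pencil of degree-$q$ curves and $Q_3=Q_1+Q_2$, each $Q_i$ being a product of $q$ distinct linear forms. A mixed triple point is a point lying on one line from each of $\mathcal{A}_1,\mathcal{A}_2,\mathcal{A}_3$; there are exactly $q^2$ of them, namely the base points $Q_1=Q_2=0$. A point of multiplicity $k$ (double, triple, quadruple, quintuple point) is a point lying on exactly $k$ lines of the arrangement. Two line arrangements are lattice isomorphic if there is a bijection between their sets of lines under which a set of lines is concurrent in one arrangement exactly when the corresponding set is concurrent in the other, i.e. the intersection lattices are isomorphic. *)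

theory Defs
  imports Complex_Main
begin

text \<open>Homogeneous coordinates in P^2(C): a point or a line is given by a
  nonzero vector (x,y,z) resp. coefficient vector (a,b,c), up to nonzero scaling.\<close>

type_synonym cvec = "complex \<times> complex \<times> complex"

definition smul3 :: "complex \<Rightarrow> cvec \<Rightarrow> cvec" where
  "smul3 c v = (case v of (x,y,z) \<Rightarrow> (c*x, c*y, c*z))"

definition incid :: "cvec \<Rightarrow> cvec \<Rightarrow> bool" where
  "incid p l = (case p of (x,y,z) \<Rightarrow> case l of (a,b,c) \<Rightarrow> a*x + b*y + c*z = 0)"

definition proj_pt :: "cvec \<Rightarrow> cvec set" where
  "proj_pt p = {smul3 c p | c. c \<noteq> 0}"

text \<open>Index set of the 9 lines: line (i,j) is the j-th line of class A_(i+1).\<close>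
definition idx :: "(nat \<times> nat) set" where
  "idx = {0..<3} \<times> {0..<3}"

definition arrangement9 :: "(nat \<times> nat \<Rightarrow> cvec) \<Rightarrow> bool" where
  "arrangement9 L \<longleftrightarrow> (\<forall>a\<in>idx. L a \<noteq> (0,0,0)) \<and>
     (\<forall>a\<in>idx. \<forall>b\<in>idx. a \<noteq> b \<longrightarrow> (\<forall>c. L b \<noteq> smul3 c (L a)))"

definition net33 :: "(nat \<times> nat \<Rightarrow> cvec) \<Rightarrow> bool" where
  "net33 L \<longleftrightarrow> arrangement9 L \<and>
     (\<forall>p. p \<noteq> (0,0,0) \<longrightarrow> (\<forall>a\<in>idx. \<forall>b\<in>idx.
        fst a \<noteq> fst b \<and> incid p (L a) \<and> incid p (L b) \<longrightarrow>
        (\<forall>k<3. card {j. j < 3 \<and> incid p (L (k,j))} = 1)))"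

definition lines_through :: "(nat \<times> nat \<Rightarrow> cvec) \<Rightarrow> cvec \<Rightarrow> (nat \<times> nat) set" where
  "lines_through L p = {a\<in>idx. incid p (L a)}"

definition mult :: "(nat \<times> nat \<Rightarrow> cvec) \<Rightarrow> cvec \<Rightarrow> nat" where
  "mult L p = card (lines_through L p)"

definition mixed :: "(nat \<times> nat \<Rightarrow> cvec) \<Rightarrow> cvec \<Rightarrow> bool" where
  "mixed L p \<longleftrightarrow> (\<forall>k<3. \<exists>j<3. incid p (L (k,j)))"

definition mpoints :: "(nat \<times> nat \<Rightarrow> cvec) \<Rightarrow> nat \<Rightarrow> cvec set set" where
  "mpoints L k = {proj_pt p | p. p \<noteq> (0,0,0) \<and> mult L p = k}"

definition mixed_points :: "(nat \<times> nat \<Rightarrow> cvec) \<Rightarrow> cvec set set" where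
  "mixed_points L = {proj_pt p | p. p \<noteq> (0,0,0) \<and> mixed L p}"

definition nonmixed_triple_points :: "(nat \<times> nat \<Rightarrow> cvec) \<Rightarrow> cvec set set" where
  "nonmixed_triple_points L =
     {proj_pt p | p. p \<noteq> (0,0,0) \<and> mult L p = 3 \<and> \<not> mixed L p}"

definition class_triple_points :: "(nat \<times> nat \<Rightarrow> cvec) \<Rightarrow> nat \<Rightarrow> cvec set set" where
  "class_triple_points L i =
     {proj_pt p | p. p \<noteq> (0,0,0) \<and> mult L p = 3 \<and> lines_through L p = {i} \<times> {0..<3}}"

definition concurrent :: "(nat \<times> nat \<Rightarrow> cvec) \<Rightarrow> (nat \<times> nat) set \<Rightarrow> bool" where
  "concurrent L S \<longleftrightarrow> (\<exists>p. p \<noteq> (0,0,0) \<and> (\<forall>a\<in>S. incid p (L a)))"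

definition lattice_iso :: "(nat \<times> nat \<Rightarrow> cvec) \<Rightarrow> (nat \<times> nat \<Rightarrow> cvec) \<Rightarrow> bool" where
  "lattice_iso L M \<longleftrightarrow> (\<exists>\<sigma>. bij_betw \<sigma> idx idx \<and>
     (\<forall>S. S \<subseteq> idx \<longrightarrow> (concurrent L S \<longleftrightarrow> concurrent M (\<sigma> ` S))))"

definition omega :: complex where
  "omega = cis (2 * pi / 3)"

text \<open>Ceva arrangement (x^3-y^3)(y^3-z^3)(z^3-x^3)=0: lines x - w^j y, y - w^j z, z - w^j x\<close>
definition ceva :: "nat \<times> nat \<Rightarrow> cvec" where
  "ceva a = (case a of (i,j) \<Rightarrow>
     if i = 0 then (1, -(omega ^ j), 0)
     else if i = 1 then (0, 1, -(omega ^ j))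
     else (-(omega ^ j), 0, 1))"

text \<open>Three singular fibres of the Hesse pencil (the three triangles other than xyz=0):
  lines x + w^i y + w^j z.\<close>
definition hesse :: "nat \<times> nat \<Rightarrow> cvec" where
  "hesse a = (case a of (i,j) \<Rightarrow> (1, omega ^ i, omega ^ j))"

text \<open>The one-parameter family of case (3): L_1,...,L_9 with L_(3i+j+1) at index (i,j).\<close>
definition fam :: "complex \<Rightarrow> nat \<times> nat \<Rightarrow> cvec" where
  "fam b a = (case a of (i,j) \<Rightarrow>
     [(0,1,0), (1/b,1,1), (b/(b-1),0,1),
      (1,0,0), (1,b,1), (0,b,1),
      (1, b*(1-b), 0), (1,1,1), (0,0,1)] ! (3*i+j))"

definition case1 :: "(nat \<times> nat \<Rightarrow> cvec) \<Rightarrow> bool" where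
  "case1 L \<longleftrightarrow> mpoints L 2 = {} \<and> card (mpoints L 3) = 12 \<and>
     (\<forall>i<3. card (class_triple_points L i) = 1) \<and> lattice_iso L ceva"

definition case2 :: "(nat \<times> nat \<Rightarrow> cvec) \<Rightarrow> bool" where
  "case2 L \<longleftrightarrow> card (mpoints L 2) = 9 \<and> card (mpoints L 3) = 9 \<and>
     nonmixed_triple_points L = {} \<and> lattice_iso L hesse"

definition case3 :: "(nat \<times> nat \<Rightarrow> cvec) \<Rightarrow> bool" where
  "case3 L \<longleftrightarrow> card (mpoints L 2) = 6 \<and> card (mpoints L 3) = 10 \<and>
     (\<exists>i<3. card (class_triple_points L i) = 1 \<and>
        (\<forall>i'<3. i' \<noteq> i \<longrightarrow> class_triple_points L i' = {})) \<and>
     (\<exists>b. b \<noteq> 0 \<and> b \<noteq> 1 \<and> b ^ 3 \<noteq> -1 \<and> lattice_iso L (fam b))"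

end

theory Submission
  imports Defs
begin

text \<open>Two lines from different classes meet in a mixed point, so a non-mixed point lies on lines of
  one class only; all counts therefore depend only on how many classes are concurrent. If two
  classes are pencils, normalising their lines at the two centres and averaging the incidence
  relations shows that the third class is a pencil too, so this number is 0, 1 or 3.
  The mixed points form a Latin square of order 3, which is unique up to relabelling, so the number
  of concurrent classes determines the lattice; it then suffices to exhibit each value in the
  Ceva arrangement, the Hesse-type arrangement and the family at \<open>b = 2\<close>.\<close>

text \<open>The obstacle is the value 2 for the number of concurrent classes. The pattern of mixed
  points is the same for every net and does not forbid it, so its exclusion has to use coordinates,
  and it divides by 3. The number of concurrent classes fixes the lattice because two lines of a
  class always meet: a set of lines can fail to be concurrent only by being a full class without a
  centre or by mixing classes outside a mixed triple. Renaming the classes, and the lines inside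
  each class, puts both kinds of data in normal form, with mixed triples given by
  \<open>i + j + k\<close> = 0 modulo 3. Lattice isomorphisms ignore the partition, so a model may
  be indexed without regard to its classes. All nets with one concurrent class share one lattice, so
  a single parameter \<open>b\<close> serves them all. The models are checked by determinants alone:
  that the nine lines are nonzero and distinct, and that they form a net, follows from which of the
  27 mixed determinants vanish.\<close>

section \<open>Cross products and determinants of homogeneous coordinates\<close>

definition cross3 :: "cvec \<Rightarrow> cvec \<Rightarrow> cvec" where
  "cross3 u v = (case u of (a,b,c) \<Rightarrow> case v of (d,e,f) \<Rightarrow> (b*f - c*e, c*d - a*f, a*e - b*d))"

definition dot3 :: "cvec \<Rightarrow> cvec \<Rightarrow> complex" where
  "dot3 u v = (case u of (a,b,c) \<Rightarrow> case v of (d,e,f) \<Rightarrow> d*a + e*b + f*c)"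

definition det3 :: "cvec \<Rightarrow> cvec \<Rightarrow> cvec \<Rightarrow> complex" where
  "det3 u v w = dot3 (cross3 u v) w"

lemma incid_iff_dot3: "incid p l \<longleftrightarrow> dot3 p l = 0"
  by (auto simp: incid_def dot3_def split: prod.splits)

lemma incid_cross3: "incid (cross3 u v) u" "incid (cross3 u v) v"
  by (cases u rule: prod_cases3, cases v rule: prod_cases3, simp add: incid_def cross3_def algebra_simps)+

lemma cross3_eq_0_imp_smul3:
  assumes "cross3 u v = (0,0,0)" "u \<noteq> (0,0,0)"
  shows "\<exists>c. v = smul3 c u"
proof -
  obtain a b c d e f where uv: "u = (a,b,c)" "v = (d,e,f)" by (metis prod.exhaust)
  have eqs: "b*f = c*e" "c*d = a*f" "a*e = b*d"
    using assms(1) by (auto simp: cross3_def uv)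
  consider "a \<noteq> 0" | "b \<noteq> 0" | "c \<noteq> 0" using assms(2) uv by auto
  then show ?thesis
  proof cases
    case 1
    then have "v = smul3 (d/a) u" using eqs by (simp add: uv smul3_def field_simps)
    then show ?thesis ..
  next
    case 2
    then have "v = smul3 (e/b) u" using eqs by (simp add: uv smul3_def field_simps)
    then show ?thesis ..
  next
    case 3
    then have "v = smul3 (f/c) u" using eqs by (simp add: uv smul3_def field_simps)
    then show ?thesis ..
  qed
qed

text \<open>By the triple product expansion, the cross product of \<open>cross3 u v\<close> with
  \<open>p\<close> is \<open>dot3 p u\<close> times \<open>v\<close> minus \<open>dot3 p v\<close>
  times \<open>u\<close>, and both coefficients vanish.\<close>

lemma incid_both_imp_smul3_cross3:
  assumes "incid p u" "incid p v" "cross3 u v \<noteq> (0,0,0)"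
  shows "\<exists>c. p = smul3 c (cross3 u v)"
proof (rule cross3_eq_0_imp_smul3[OF _ assms(3)])
  obtain a b c d e f x y z where uv: "u = (a,b,c)" "v = (d,e,f)" "p = (x,y,z)"
    by (metis prod.exhaust)
  have E: "a*x + b*y + c*z = 0" "d*x + e*y + f*z = 0"
    using assms(1,2) by (auto simp: uv incid_def)
  have "(c*d - a*f)*z - (a*e - b*d)*y = d*(a*x + b*y + c*z) - a*(d*x + e*y + f*z)"
    "(a*e - b*d)*x - (b*f - c*e)*z = e*(a*x + b*y + c*z) - b*(d*x + e*y + f*z)"
    "(b*f - c*e)*y - (c*d - a*f)*x = f*(a*x + b*y + c*z) - c*(d*x + e*y + f*z)"
    by algebra+
  then show "cross3 (cross3 u v) p = (0,0,0)"
    using E by (simp add: uv cross3_def)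
qed

lemma smul3_zero_iff: "smul3 c p = (0,0,0) \<longleftrightarrow> c = 0 \<or> p = (0,0,0)"
  by (cases p) (auto simp: smul3_def)

lemma incid_smul3_left: "c \<noteq> 0 \<Longrightarrow> incid (smul3 c p) l \<longleftrightarrow> incid p l"
proof -
  assume c: "c \<noteq> 0"
  obtain x y z d e f where eq: "p = (x,y,z)" "l = (d,e,f)" by (metis prod.exhaust)
  have "d*(c*x) + e*(c*y) + f*(c*z) = c*(d*x + e*y + f*z)" by algebra
  then show ?thesis using c by (simp add: eq smul3_def incid_def)
qed

lemma incid_smul3_right: "incid p l \<Longrightarrow> incid p (smul3 c l)"
proof -
  assume i: "incid p l"
  obtain x y z d e f where eq: "p = (x,y,z)" "l = (d,e,f)" by (metis prod.exhaust)
  have "c*d*x + c*e*y + c*f*z = c*(d*x + e*y + f*z)" by algebra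
  then show ?thesis using i by (simp add: eq smul3_def incid_def)
qed

lemma smul3_smul3: "smul3 c (smul3 d p) = smul3 (c*d) p"
  by (cases p) (auto simp: smul3_def)

lemma smul3_1 [simp]: "smul3 1 p = p"
  by (cases p) (simp add: smul3_def)

lemma proj_pt_smul3:
  assumes c: "c \<noteq> 0"
  shows "proj_pt (smul3 c p) = proj_pt p"
proof
  show "proj_pt (smul3 c p) \<subseteq> proj_pt p"
    unfolding proj_pt_def using c smul3_smul3 by fastforce
  show "proj_pt p \<subseteq> proj_pt (smul3 c p)"
  proof
    fix q assume "q \<in> proj_pt p"
    then obtain d where d: "d \<noteq> 0" "q = smul3 d p" unfolding proj_pt_def by blast
    have "q = smul3 (d/c) (smul3 c p)" "d/c \<noteq> 0" using c d by (simp_all add: smul3_smul3)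
    then show "q \<in> proj_pt (smul3 c p)" unfolding proj_pt_def by blast
  qed
qed

lemma proj_pt_eqD: "proj_pt p = proj_pt q \<Longrightarrow> \<exists>c. c \<noteq> 0 \<and> p = smul3 c q"
proof -
  assume e: "proj_pt p = proj_pt q"
  have "p = smul3 1 p" "(1::complex) \<noteq> 0" by simp_all
  then have "p \<in> proj_pt p" unfolding proj_pt_def by blast
  then have "p \<in> proj_pt q" using e by simp
  then show ?thesis unfolding proj_pt_def by blast
qed

lemma det3_eq_0_if_common_point:
  assumes "p \<noteq> (0,0,0)" "incid p u" "incid p v" "incid p w"
  shows "det3 u v w = 0"
proof (cases "cross3 u v = (0,0,0)")
  case True
  then show ?thesis by (auto simp: det3_def dot3_def split: prod.splits)
next
  case False
  then obtain c where c: "p = smul3 c (cross3 u v)"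
    using incid_both_imp_smul3_cross3 assms by blast
  then have "c \<noteq> 0" using assms(1) by (auto simp: smul3_zero_iff)
  then show ?thesis using assms(4) c by (metis incid_smul3_left incid_iff_dot3 det3_def)
qed

lemma det3_eq_0_imp_common_point:
  assumes "det3 u v w = 0" "cross3 u v \<noteq> (0,0,0)"
  shows "\<exists>p. p \<noteq> (0,0,0) \<and> incid p u \<and> incid p v \<and> incid p w"
  using assms incid_cross3 by (metis det3_def incid_iff_dot3)

definition comb3 :: "complex \<Rightarrow> cvec \<Rightarrow> complex \<Rightarrow> cvec \<Rightarrow> cvec" where
  "comb3 s u t v = (case u of (a,b,c) \<Rightarrow> case v of (d,e,f) \<Rightarrow> (s*a + t*d, s*b + t*e, s*c + t*f))"

lemma dot3_comb3: "dot3 p (comb3 s u t v) = s * dot3 p u + t * dot3 p v"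
  by (cases p rule: prod_cases3, cases u rule: prod_cases3, cases v rule: prod_cases3) (simp add: dot3_def comb3_def algebra_simps)

lemma dot3_smul3: "dot3 p (smul3 s u) = s * dot3 p u"
  by (cases p rule: prod_cases3, cases u rule: prod_cases3) (simp add: dot3_def smul3_def algebra_simps)

lemma cross3_smul3: "cross3 (smul3 s u) (smul3 t v) = smul3 (s*t) (cross3 u v)"
  by (cases u rule: prod_cases3, cases v rule: prod_cases3) (simp add: cross3_def smul3_def algebra_simps)

lemma det3_smul3: "det3 (smul3 s u) (smul3 t v) w = s * t * det3 u v w"
  by (cases u rule: prod_cases3, cases v rule: prod_cases3, cases w rule: prod_cases3) (simp add: det3_def dot3_def cross3_def smul3_def algebra_simps)

lemma det3_comb3_eq_0: "det3 (comb3 s u t v) (comb3 s' u t' v) (comb3 s'' u t'' v) = 0"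
  by (cases u rule: prod_cases3, cases v rule: prod_cases3) (simp add: det3_def dot3_def cross3_def comb3_def algebra_simps)

text \<open>Cramer's rule: the coefficients are the quotients of \<open>cross3 w v\<close> and
  \<open>cross3 u w\<close> by \<open>cross3 u v\<close>, read in one coordinate where the
  denominator is nonzero. In each case the vanishing determinant enters only in the equation for
  that coordinate.\<close>

lemma det3_eq_0_imp_comb3:
  assumes "det3 u v w = 0" "cross3 u v \<noteq> (0,0,0)"
  shows "\<exists>s t. w = comb3 s u t v"
proof -
  obtain a b c d e f x y z where uv: "u = (a,b,c)" "v = (d,e,f)" "w = (x,y,z)"
    by (metis prod.exhaust)
  have det: "(b*f - c*e)*x + (c*d - a*f)*y + (a*e - b*d)*z = 0"
    using assms(1) by (simp add: uv det3_def dot3_def cross3_def algebra_simps)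
  have quot: "h = p / g * m + q / g * n" if "g \<noteq> 0" "g * h = p * m + q * n" for g h m n p q :: complex
  proof -
    have "h = (p * m + q * n) / g" using that by (simp add: eq_divide_eq mult.commute)
    then show ?thesis by (simp add: add_divide_distrib)
  qed
  consider "b*f - c*e \<noteq> 0" | "c*d - a*f \<noteq> 0" | "a*e - b*d \<noteq> 0"
    using assms(2) by (auto simp: uv cross3_def)
  then show ?thesis
  proof cases
    case 1
    define g where "g = b*f - c*e"
    have "g*x = (f*y - e*z)*a + (b*z - c*y)*d" "g*y = (f*y - e*z)*b + (b*z - c*y)*e"
      "g*z = (f*y - e*z)*c + (b*z - c*y)*f"
      using det unfolding g_def by algebra+
    then have "w = comb3 ((f*y - e*z)/g) u ((b*z - c*y)/g) v"
      using 1[folded g_def] unfolding uv comb3_def prod.case prod.inject by (intro conjI quot)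
    then show ?thesis by blast
  next
    case 2
    define g where "g = c*d - a*f"
    have "g*x = (d*z - f*x)*a + (c*x - a*z)*d" "g*y = (d*z - f*x)*b + (c*x - a*z)*e"
      "g*z = (d*z - f*x)*c + (c*x - a*z)*f"
      using det unfolding g_def by (simp add: algebra_simps, algebra, simp add: algebra_simps)
    then have "w = comb3 ((d*z - f*x)/g) u ((c*x - a*z)/g) v"
      using 2[folded g_def] unfolding uv comb3_def prod.case prod.inject by (intro conjI quot)
    then show ?thesis by blast
  next
    case 3
    define g where "g = a*e - b*d"
    have "g*x = (e*x - d*y)*a + (a*y - b*x)*d" "g*y = (e*x - d*y)*b + (a*y - b*x)*e"
      "g*z = (e*x - d*y)*c + (a*y - b*x)*f"
      using det unfolding g_def by (simp add: algebra_simps, simp add: algebra_simps, algebra)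
    then have "w = comb3 ((e*x - d*y)/g) u ((a*y - b*x)/g) v"
      using 3[folded g_def] unfolding uv comb3_def prod.case prod.inject by (intro conjI quot)
    then show ?thesis by blast
  qed
qed

section \<open>Two concurrent classes force the third\<close>

text \<open>The net enters only through the permutations \<open>\<sigma> k\<close>: the line
  \<open>C k\<close> meets each \<open>A i\<close> in a mixed point, and
  \<open>B (\<sigma> k i)\<close> is the line of the second class through that point. The centres of
  the two pencils are \<open>p1\<close> and \<open>p2\<close>.\<close>

lemma two_pencils_force_third:
  fixes A B C :: "nat \<Rightarrow> cvec" and \<sigma> :: "nat \<Rightarrow> nat \<Rightarrow> nat"
  assumes A: "\<And>i. i < 3 \<Longrightarrow> dot3 p1 (A i) = 0" "\<And>i. i < 3 \<Longrightarrow> dot3 p2 (A i) \<noteq> 0"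
    and B: "\<And>j. j < 3 \<Longrightarrow> dot3 p2 (B j) = 0" "\<And>j. j < 3 \<Longrightarrow> dot3 p1 (B j) \<noteq> 0"
    and \<sigma>: "\<And>k. k < 3 \<Longrightarrow> bij_betw (\<sigma> k) {..<3} {..<3}"
    and AB: "\<And>i j. i < 3 \<Longrightarrow> j < 3 \<Longrightarrow> cross3 (A i) (B j) \<noteq> (0,0,0)"
    and det: "\<And>i k. i < 3 \<Longrightarrow> k < 3 \<Longrightarrow> det3 (A i) (B (\<sigma> k i)) (C k) = 0"
  shows "det3 (C 0) (C 1) (C 2) = 0"
proof -
  \<comment> \<open>Scale the lines so that each takes the value 1 at the other centre. Then the coefficients
    of \<open>C k\<close> in terms of \<open>a i\<close> and \<open>b (\<sigma> k i)\<close> do not depend on \<open>i\<close>, and averaging over \<open>i\<close>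
    puts every \<open>C k\<close> in the span of the two centroids.\<close>
  define a where "a i = smul3 (1 / dot3 p2 (A i)) (A i)" for i
  define b where "b j = smul3 (1 / dot3 p1 (B j)) (B j)" for j
  define X where "X = (\<Sum>i<3. fst (a i), \<Sum>i<3. fst (snd (a i)), \<Sum>i<3. snd (snd (a i)))"
  define Y where "Y = (\<Sum>i<3. fst (b i), \<Sum>i<3. fst (snd (b i)), \<Sum>i<3. snd (snd (b i)))"
  have C: "C k = comb3 (dot3 p2 (C k)) (a i) (dot3 p1 (C k)) (b (\<sigma> k i))"
    if k: "k < 3" and i: "i < 3" for k i
  proof -
    have j: "\<sigma> k i < 3" using \<sigma>[OF k] i by (auto simp: bij_betw_def)
    have "cross3 (a i) (b (\<sigma> k i)) \<noteq> (0,0,0)"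
      using A(2)[OF i] B(2)[OF j] AB[OF i j] by (simp add: a_def b_def cross3_smul3 smul3_zero_iff)
    moreover have "det3 (a i) (b (\<sigma> k i)) (C k) = 0"
      using det[OF i k] by (simp add: a_def b_def det3_smul3)
    ultimately obtain s t where st: "C k = comb3 s (a i) t (b (\<sigma> k i))"
      using det3_eq_0_imp_comb3 by blast
    \<comment> \<open>At each centre one of the two summands vanishes and the other has value 1, so
      the coefficients are values of \<open>C k\<close> and cannot depend on
      \<open>i\<close>.\<close>
    have "dot3 p2 (C k) = s" "dot3 p1 (C k) = t"
      using A[OF i] B[OF j] by (simp_all add: st dot3_comb3 a_def b_def dot3_smul3)
    then show ?thesis using st by simp
  qed
  have "C k = comb3 (dot3 p2 (C k) / 3) X (dot3 p1 (C k) / 3) Y" if k: "k < 3" for k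
  proof -
    define s where "s = dot3 p2 (C k)"
    define t where "t = dot3 p1 (C k)"
    \<comment> \<open>This is where \<open>\<sigma> k\<close> has to be a permutation: the sum over
      the second pencil becomes independent of \<open>k\<close>.\<close>
    have re: "(\<Sum>i<3. g (b (\<sigma> k i))) = (\<Sum>j<3. g (b j))" for g :: "cvec \<Rightarrow> complex"
      by (rule sum.reindex_bij_betw[OF \<sigma>[OF k], of "\<lambda>j. g (b j)"])
    have comp: "fst (C k) = s * fst (a i) + t * fst (b (\<sigma> k i))"
      "fst (snd (C k)) = s * fst (snd (a i)) + t * fst (snd (b (\<sigma> k i)))"
      "snd (snd (C k)) = s * snd (snd (a i)) + t * snd (snd (b (\<sigma> k i)))" if "i < 3" for i
      using C[OF k that] unfolding s_def[symmetric] t_def[symmetric]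
      by (simp_all add: comb3_def split: prod.splits)
    have avg: "3 * g (C k) = s * (\<Sum>i<3. g (a i)) + t * (\<Sum>i<3. g (b i))"
      if g: "\<And>i. i < 3 \<Longrightarrow> g (C k) = s * g (a i) + t * g (b (\<sigma> k i))" for g :: "cvec \<Rightarrow> complex"
    proof -
      have "3 * g (C k) = (\<Sum>i<3::nat. g (C k))" by simp
      also have "\<dots> = (\<Sum>i<3. s * g (a i) + t * g (b (\<sigma> k i)))"
        using g by (intro sum.cong) auto
      also have "\<dots> = s * (\<Sum>i<3. g (a i)) + t * (\<Sum>i<3. g (b (\<sigma> k i)))"
        by (simp add: sum.distrib sum_distrib_left)
      finally show ?thesis by (simp add: re)
    qed
    have "C k = comb3 (s/3) X (t/3) Y"
      using avg[of fst, OF comp(1)] avg[of "\<lambda>v. fst (snd v)", OF comp(2)]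
        avg[of "\<lambda>v. snd (snd v)", OF comp(3)]
      by (cases "C k") (simp add: comb3_def X_def Y_def field_simps)
    then show ?thesis by (simp add: s_def t_def)
  qed
  then have "\<exists>s t. C k = comb3 s X t Y" if "k < 3" for k using that by blast
  from this[of 0] this[of 1] this[of 2] show ?thesis
    by (auto simp: det3_comb3_eq_0)
qed

section \<open>Concurrent classes and the set of lines through a point\<close>

lemma all_less_3: "(\<forall>k<3. P k) \<longleftrightarrow> P 0 \<and> P 1 \<and> P (2::nat)"
  by (auto simp: numeral_eq_Suc less_Suc_eq)

definition concurrent_classes :: "(nat \<times> nat \<Rightarrow> cvec) \<Rightarrow> nat set" where
  "concurrent_classes L = {c. c < 3 \<and> concurrent L ({c} \<times> {0..<3})}"

lemma concurrent_iff_lines_through: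
  assumes "S \<subseteq> idx"
  shows "concurrent L S \<longleftrightarrow> (\<exists>p. p \<noteq> (0,0,0) \<and> S \<subseteq> lines_through L p)"
  using assms unfolding concurrent_def lines_through_def by blast

lemma in_idx_iff [simp]: "(c, i) \<in> idx \<longleftrightarrow> c < 3 \<and> i < 3"
  by (simp add: idx_def)

lemma finite_lines_through [simp]: "finite (lines_through L p)"
  unfolding lines_through_def idx_def by simp

lemma lines_through_smul3: "c \<noteq> 0 \<Longrightarrow> lines_through L (smul3 c p) = lines_through L p"
  by (simp add: lines_through_def incid_smul3_left)

lemma mixed_iff_lines_through:
  "mixed L p \<longleftrightarrow> (\<forall>k<3. \<exists>j<3. (k,j) \<in> lines_through L p)"
  by (auto simp: mixed_def lines_through_def)

lemma two_elements_of_card_ge_2: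
  assumes "2 \<le> card A"
  obtains a b where "a \<in> A" "b \<in> A" "a \<noteq> b"
proof -
  obtain B where "B \<subseteq> A" "card B = 2" using obtain_subset_with_card_n[OF assms] by metis
  then show thesis using that by (auto simp: card_2_iff)
qed

text \<open>Projective points and sets of line indices are both images of the same set of coordinate
  vectors. This lemma turns a count of points into a count of index sets.\<close>

lemma same_fibers_imp_bij_betw:
  assumes "\<And>x y. x \<in> X \<Longrightarrow> y \<in> X \<Longrightarrow> f x = f y \<longleftrightarrow> g x = g y"
  shows "\<exists>h. bij_betw h (f ` X) (g ` X)"
proof -
  \<comment> \<open>The chosen preimage does not matter, since \<open>g\<close> is constant on the
    fibres of \<open>f\<close>.\<close>
  define h where "h z = g (SOME x. x \<in> X \<and> f x = z)" for z
  have h: "h (f x) = g x" if "x \<in> X" for x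
  proof -
    have "\<exists>y. y \<in> X \<and> f y = f x" using that by blast
    then have "(SOME y. y \<in> X \<and> f y = f x) \<in> X \<and> f (SOME y. y \<in> X \<and> f y = f x) = f x"
      by (rule someI_ex)
    then show ?thesis using assms that unfolding h_def by blast
  qed
  have "bij_betw h (f ` X) (g ` X)"
    unfolding bij_betw_def
  proof
    show "inj_on h (f ` X)" using h assms by (auto simp: inj_on_def)
    show "h ` f ` X = g ` X" using h by (simp add: image_image)
  qed
  then show ?thesis by blast
qed

section \<open>Points of a net: mixed points and points inside one class\<close>

context
  fixes L :: "nat \<times> nat \<Rightarrow> cvec"
  assumes net: "net33 L"
begin

lemma cross3_lines_nonzero:
  assumes "a \<in> idx" "b \<in> idx" "a \<noteq> b"
  shows "cross3 (L a) (L b) \<noteq> (0,0,0)"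
proof
  assume "cross3 (L a) (L b) = (0,0,0)"
  moreover have "L a \<noteq> (0,0,0)" using net assms(1) unfolding net33_def arrangement9_def by blast
  ultimately obtain c where "L b = smul3 c (L a)" using cross3_eq_0_imp_smul3 by blast
  then show False using net assms unfolding net33_def arrangement9_def by blast
qed

lemma point_on_two_lines_unique:
  assumes "a \<in> idx" "b \<in> idx" "a \<noteq> b" "p \<noteq> (0,0,0)" "q \<noteq> (0,0,0)"
    and "incid p (L a)" "incid p (L b)" "incid q (L a)" "incid q (L b)"
  shows "\<exists>c. c \<noteq> 0 \<and> p = smul3 c q"
proof -
  define x where "x = cross3 (L a) (L b)"
  have x: "x \<noteq> (0,0,0)" unfolding x_def by (rule cross3_lines_nonzero[OF assms(1-3)])
  obtain s where s: "p = smul3 s x" using incid_both_imp_smul3_cross3 assms x x_def by blast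
  obtain t where t: "q = smul3 t x" using incid_both_imp_smul3_cross3 assms x x_def by blast
  have "s \<noteq> 0" "t \<noteq> 0" using s t assms(4,5) by (auto simp: smul3_zero_iff)
  then have "p = smul3 (s/t) q" "s/t \<noteq> 0" by (simp_all add: s t smul3_smul3)
  then show ?thesis by blast
qed

lemma lines_through_eq_if_two_common:
  assumes "p \<noteq> (0,0,0)" "q \<noteq> (0,0,0)" "a \<noteq> b"
    and "a \<in> lines_through L p" "b \<in> lines_through L p"
    and "a \<in> lines_through L q" "b \<in> lines_through L q"
  shows "proj_pt p = proj_pt q \<and> lines_through L p = lines_through L q"
proof -
  obtain c where "c \<noteq> 0" "p = smul3 c q"
    using point_on_two_lines_unique[of a b p q] assms unfolding lines_through_def by blast
  then show ?thesis by (simp add: proj_pt_smul3 lines_through_smul3)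
qed

text \<open>Two lines determine their common point, so from multiplicity 2 on a point can be
  recovered from its lines.\<close>

lemma proj_pt_eq_iff_lines_through_eq:
  assumes "p \<noteq> (0,0,0)" "q \<noteq> (0,0,0)" "2 \<le> mult L p"
  shows "proj_pt p = proj_pt q \<longleftrightarrow> lines_through L p = lines_through L q"
proof
  assume "proj_pt p = proj_pt q"
  then show "lines_through L p = lines_through L q"
    using proj_pt_eqD lines_through_smul3 by blast
next
  assume eq: "lines_through L p = lines_through L q"
  obtain a b where "a \<in> lines_through L p" "b \<in> lines_through L p" "a \<noteq> b"
    using assms(3) two_elements_of_card_ge_2 unfolding mult_def by blast
  then show "proj_pt p = proj_pt q"
    using lines_through_eq_if_two_common eq assms by blast
qed

lemma points_bij_betw_lines_through:
  assumes "\<And>p. p \<in> X \<Longrightarrow> p \<noteq> (0,0,0) \<and> 2 \<le> mult L p"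
  shows "\<exists>h. bij_betw h (proj_pt ` X) (lines_through L ` X)"
  using proj_pt_eq_iff_lines_through_eq assms by (intro same_fibers_imp_bij_betw) blast

lemma lines_through_two_classes:
  assumes "p \<noteq> (0,0,0)" "a \<in> lines_through L p" "b \<in> lines_through L p" "fst a \<noteq> fst b" "k < 3"
  shows "\<exists>!j. (k,j) \<in> lines_through L p"
proof -
  have "card {j. j < 3 \<and> incid p (L (k,j))} = 1"
    using net assms unfolding net33_def lines_through_def by blast
  moreover have "{j. j < 3 \<and> incid p (L (k,j))} = {j. (k,j) \<in> lines_through L p}"
    using assms(5) by (auto simp: lines_through_def)
  ultimately obtain j where "{j. (k,j) \<in> lines_through L p} = {j}"
    by (auto simp: card_1_singleton_iff)
  then have "(k,i) \<in> lines_through L p \<longleftrightarrow> i = j" for i by (simp add: set_eq_iff)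
  then show ?thesis by simp
qed

lemma mixed_if_two_classes:
  assumes "p \<noteq> (0,0,0)" "a \<in> lines_through L p" "b \<in> lines_through L p" "fst a \<noteq> fst b"
  shows "mixed L p"
  unfolding mixed_iff_lines_through
proof (intro allI impI)
  fix k :: nat
  assume k: "k < 3"
  obtain j where j: "(k,j) \<in> lines_through L p" using lines_through_two_classes[OF assms k] by blast
  then have "j < 3" by (simp add: lines_through_def)
  then show "\<exists>j<3. (k,j) \<in> lines_through L p" using j by blast
qed

lemma mixed_unique:
  assumes "p \<noteq> (0,0,0)" "mixed L p" "k < 3"
  shows "\<exists>!j. (k,j) \<in> lines_through L p"
proof -
  obtain i j where "(0,i) \<in> lines_through L p" "(1,j) \<in> lines_through L p"
    using assms(2) unfolding mixed_iff_lines_through all_less_3 by blast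
  then show ?thesis using lines_through_two_classes[OF assms(1), of "(0,i)" "(1,j)"] assms(3) by simp
qed

lemma mixed_lines_through:
  assumes "p \<noteq> (0,0,0)" "mixed L p" "(0,i) \<in> lines_through L p" "(1,j) \<in> lines_through L p"
    "(2,k) \<in> lines_through L p"
  shows "lines_through L p = {(0,i),(1,j),(2,k)}"
proof -
  have "x \<in> {(0,i),(1,j),(2,k)}" if "x \<in> lines_through L p" for x
  proof -
    obtain c l where x: "x = (c,l)" by (cases x)
    have "c < 3" using that x by (auto simp: lines_through_def)
    then have "c = 0 \<or> c = 1 \<or> c = 2" by auto
    then show ?thesis
      using mixed_unique[OF assms(1,2) \<open>c < 3\<close>] assms(3-5) that unfolding x by blast
  qed
  then show ?thesis using assms(3-5) by blast
qed

lemma mixed_obtain: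
  assumes "p \<noteq> (0,0,0)" "mixed L p"
  obtains i j k where "i < 3" "j < 3" "k < 3" "lines_through L p = {(0,i),(1,j),(2,k)}"
proof -
  obtain i j k where ijk: "(0,i) \<in> lines_through L p" "(1,j) \<in> lines_through L p"
    "(2,k) \<in> lines_through L p"
    using assms(2) unfolding mixed_iff_lines_through all_less_3 by blast
  have lt: "i < 3" "j < 3" "k < 3" using ijk by (simp_all add: lines_through_def)
  show thesis by (rule that[OF lt mixed_lines_through[OF assms ijk]])
qed

lemma mult_mixed:
  assumes "p \<noteq> (0,0,0)" "mixed L p"
  shows "mult L p = 3"
proof -
  obtain i j k where "lines_through L p = {(0,i),(1,j),(2,k)}" using mixed_obtain[OF assms] .
  then show ?thesis by (simp add: mult_def)
qed

lemma nonmixed_obtain_class: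
  assumes "p \<noteq> (0,0,0)" "\<not> mixed L p"
  obtains c where "c < 3" "lines_through L p \<subseteq> {c} \<times> {0..<3}"
proof (cases "lines_through L p = {}")
  case True
  \<comment> \<open>A point on no line fits into every class; class 0 is an arbitrary
    choice.\<close>
  then show thesis using that[of 0] by simp
next
  case False
  then obtain a where a: "a \<in> lines_through L p" by blast
  have same: "fst b = fst a" if "b \<in> lines_through L p" for b
    using mixed_if_two_classes[OF assms(1) that a] assms(2) by blast
  have idx: "lines_through L p \<subseteq> idx" by (auto simp: lines_through_def)
  have "fst a < 3" using a idx by (auto simp: idx_def)
  moreover have "lines_through L p \<subseteq> {fst a} \<times> {0..<3}"
  proof
    fix b assume b: "b \<in> lines_through L p"
    then have "b \<in> idx" using idx by blast
    then show "b \<in> {fst a} \<times> {0..<3}"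
      unfolding same[OF b, symmetric] by (auto simp: idx_def)
  qed
  ultimately show thesis by (rule that)
qed

lemma mult_nonmixed_eq_3_iff:
  assumes "p \<noteq> (0,0,0)" "\<not> mixed L p"
  shows "mult L p = 3 \<longleftrightarrow> (\<exists>c<3. lines_through L p = {c} \<times> {0..<3})"
proof -
  obtain c where c: "c < 3" "lines_through L p \<subseteq> {c} \<times> {0..<3}"
    using nonmixed_obtain_class[OF assms] .
  have "lines_through L p = {c} \<times> {0..<3}" if "mult L p = 3"
    using c(2) that by (intro card_subset_eq) (auto simp: mult_def)
  then show ?thesis using c by (auto simp: mult_def)
qed

lemma mult_le_3:
  assumes "p \<noteq> (0,0,0)"
  shows "mult L p \<le> 3"
proof (cases "mixed L p")
  case True
  then show ?thesis using mult_mixed assms by simp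
next
  case False
  obtain c where "lines_through L p \<subseteq> {c} \<times> {0..<3}"
    using nonmixed_obtain_class[OF assms False] .
  then have "card (lines_through L p) \<le> card ({c} \<times> {0..<3::nat})"
    by (intro card_mono) auto
  then show ?thesis by (simp add: mult_def)
qed

lemma not_mixed_if_class_subset:
  assumes "p \<noteq> (0,0,0)" "(c,i) \<in> lines_through L p" "(c,j) \<in> lines_through L p" "i \<noteq> j"
  shows "\<not> mixed L p"
  using mixed_unique[OF assms(1), of c] assms(2-) by (auto simp: lines_through_def)

text \<open>Two lines of one class through the centre prevent it from being mixed, and the bound 3
  on multiplicities leaves no room for a further line.\<close>

lemma class_point:
  assumes "c \<in> concurrent_classes L"
  shows "\<exists>p. p \<noteq> (0,0,0) \<and> \<not> mixed L p \<and> lines_through L p = {c} \<times> {0..<3}"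
proof -
  have c: "c < 3" "concurrent L ({c} \<times> {0..<3})"
    using assms by (auto simp: concurrent_classes_def)
  have "{c} \<times> {0..<3} \<subseteq> idx" using c(1) by auto
  then obtain p where p: "p \<noteq> (0,0,0)" "{c} \<times> {0..<3} \<subseteq> lines_through L p"
    using concurrent_iff_lines_through c(2) by blast
  have "(c,0) \<in> lines_through L p" "(c,1) \<in> lines_through L p"
    by (rule subsetD[OF p(2)], simp)+
  then have nm: "\<not> mixed L p" using not_mixed_if_class_subset[OF p(1)] by force
  have "lines_through L p = {c} \<times> {0..<3}"
    using mult_le_3[OF p(1)] p(2) by (intro card_seteq[symmetric]) (auto simp: mult_def)
  then show ?thesis using p nm by blast
qed

lemma meet_point:
  assumes "a \<in> idx" "b \<in> idx" "a \<noteq> b"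
  shows "\<exists>p. p \<noteq> (0,0,0) \<and> a \<in> lines_through L p \<and> b \<in> lines_through L p"
  using cross3_lines_nonzero[OF assms] incid_cross3[of "L a" "L b"] assms
  unfolding lines_through_def by blast

section \<open>Counting mixed, triple and double points\<close>

lemma finite_points_if_lines_through:
  assumes "\<And>p. p \<in> X \<Longrightarrow> p \<noteq> (0,0,0) \<and> 2 \<le> mult L p"
  shows "finite (proj_pt ` X)" "card (proj_pt ` X) = card (lines_through L ` X)"
proof -
  obtain h where h: "bij_betw h (proj_pt ` X) (lines_through L ` X)"
    using points_bij_betw_lines_through[OF assms] by blast
  have "lines_through L ` X \<subseteq> Pow idx" by (auto simp: lines_through_def)
  then have "finite (lines_through L ` X)" by (rule finite_subset) (simp add: idx_def)
  then show "finite (proj_pt ` X)" using bij_betw_finite[OF h] by simp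
  show "card (proj_pt ` X) = card (lines_through L ` X)" by (rule bij_betw_same_card[OF h])
qed

text \<open>A mixed point is determined by its lines in classes 0 and 1, and any line of class 0
  meets any line of class 1 in a mixed point. This matches mixed points with the 9 pairs of
  indices.\<close>

lemma card_mixed_points: "card (mixed_points L) = 9"
proof -
  let ?X = "{p. p \<noteq> (0,0,0) \<and> mixed L p}"
  have X: "p \<noteq> (0,0,0) \<and> 2 \<le> mult L p" if "p \<in> ?X" for p
    using that mult_mixed by simp
  have eq: "mixed_points L = proj_pt ` ?X" by (auto simp only: mixed_points_def image_def)
  have 1: "card (mixed_points L) = card (lines_through L ` ?X)"
    unfolding eq by (rule finite_points_if_lines_through(2)[OF X])
  \<comment> \<open>Reads off which line of class 0 and which line of class 1 belong to the
    set.\<close>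
  define g where "g S = (THE ij. (0, fst ij) \<in> S \<and> (1, snd ij) \<in> S)" for S :: "(nat \<times> nat) set"
  have g: "g {(0,i),(1,j),(2,k)} = (i,j)" for i j k
    unfolding g_def by (rule the_equality) auto
  have "bij_betw g (lines_through L ` ?X) ({..<3} \<times> {..<3})"
    unfolding bij_betw_def
  proof
    show "inj_on g (lines_through L ` ?X)"
    proof (rule inj_onI)
      fix S T assume "S \<in> lines_through L ` ?X" "T \<in> lines_through L ` ?X" and eq: "g S = g T"
      then obtain p q where p: "p \<noteq> (0,0,0)" "mixed L p" "S = lines_through L p"
        and q: "q \<noteq> (0,0,0)" "mixed L q" "T = lines_through L q" by blast
      obtain i j k where S: "S = {(0,i),(1,j),(2,k)}" using mixed_obtain[OF p(1,2), folded p(3)] .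
      obtain i' j' k' where T: "T = {(0,i'),(1,j'),(2,k')}"
        using mixed_obtain[OF q(1,2), folded q(3)] .
      have "i' = i" "j' = j" using eq S T g by auto
      then show "S = T"
        using lines_through_eq_if_two_common[OF p(1) q(1), of "(0,i)" "(1,j)"] S T p(3) q(3) by auto
    qed
    show "g ` lines_through L ` ?X = {..<3} \<times> {..<3}"
    proof
      show "g ` lines_through L ` ?X \<subseteq> {..<3} \<times> {..<3}"
      proof (unfold image_image, rule image_subsetI)
        fix p assume "p \<in> ?X"
        then have p: "p \<noteq> (0,0,0)" "mixed L p" by simp_all
        obtain a b c where "a < 3" "b < 3" "lines_through L p = {(0,a),(1,b),(2,c)}"
          using mixed_obtain[OF p] .
        then show "g (lines_through L p) \<in> {..<3} \<times> {..<3}" using g by simp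
      qed
      show "{..<3} \<times> {..<3} \<subseteq> g ` lines_through L ` ?X"
      proof (rule subsetI)
        fix ij :: "nat \<times> nat" assume mem: "ij \<in> {..<3} \<times> {..<3}"
        obtain i j where e: "ij = (i,j)" by (cases ij)
        have ij: "i < 3" "j < 3" using mem e by auto
        obtain p where p: "p \<noteq> (0,0,0)" "(0,i) \<in> lines_through L p" "(1,j) \<in> lines_through L p"
          using meet_point[of "(0,i)" "(1,j)"] ij by auto
        then have m: "mixed L p" using mixed_if_two_classes[OF p] by simp
        obtain a b c where abc: "lines_through L p = {(0,a),(1,b),(2,c)}"
          using mixed_obtain[OF p(1) m] .
        then have "a = i" "b = j" using p by auto
        then have gp: "g (lines_through L p) = ij" unfolding abc e using g by simp
        have "p \<in> ?X" using p(1) m by simp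
        then have "g (lines_through L p) \<in> g ` lines_through L ` ?X" by (intro imageI)
        then show "ij \<in> g ` lines_through L ` ?X" unfolding gp .
      qed
    qed
  qed
  from bij_betw_same_card[OF this] show ?thesis unfolding 1 by simp
qed

text \<open>An infinite set would have \<open>card\<close> equal to 0, not 9.\<close>

lemma finite_mixed_points: "finite (mixed_points L)"
  by (rule card_ge_0_finite) (simp add: card_mixed_points)

lemma finite_concurrent_classes: "finite (concurrent_classes L)"
  by (simp add: concurrent_classes_def)

lemma nonmixed_triple_points_image:
  "lines_through L ` {p. p \<noteq> (0,0,0) \<and> mult L p = 3 \<and> \<not> mixed L p}
    = (\<lambda>c. {c} \<times> {0..<3}) ` concurrent_classes L" (is "?A = ?B")
proof
  show "?A \<subseteq> ?B"
  proof
    fix S assume "S \<in> ?A"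
    then obtain p where p: "p \<noteq> (0,0,0)" "mult L p = 3" "\<not> mixed L p" "S = lines_through L p" by blast
    obtain c where c: "c < 3" "lines_through L p = {c} \<times> {0..<3}"
      using mult_nonmixed_eq_3_iff[OF p(1,3)] p(2) by blast
    have "{c} \<times> {0..<3} \<subseteq> idx" using c(1) by auto
    then have "concurrent L ({c} \<times> {0..<3})"
      using p(1) c(2) concurrent_iff_lines_through[of "{c} \<times> {0..<3}" L] by blast
    then have "c \<in> concurrent_classes L" using c(1) by (simp add: concurrent_classes_def)
    then show "S \<in> ?B" unfolding p(4) c(2) by (rule imageI)
  qed
  show "?B \<subseteq> ?A"
  proof
    fix S assume "S \<in> ?B"
    then obtain c where c: "c \<in> concurrent_classes L" "S = {c} \<times> {0..<3}" by blast
    obtain p where p: "p \<noteq> (0,0,0)" "\<not> mixed L p" "lines_through L p = S"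
      using class_point[OF c(1)] c(2) by blast
    have "mult L p = 3" using p(3) c(2) by (simp add: mult_def)
    then have "p \<in> {p. p \<noteq> (0,0,0) \<and> mult L p = 3 \<and> \<not> mixed L p}" using p(1,2) by simp
    then show "S \<in> ?A" unfolding p(3)[symmetric] by (rule imageI)
  qed
qed

lemma inj_class_block: "inj (\<lambda>c::nat. {c} \<times> {0..<3::nat})"
  by (auto simp: inj_def times_eq_iff)

lemma nonmixed_triple_points_finite_card:
  "finite (nonmixed_triple_points L)"
  "card (nonmixed_triple_points L) = card (concurrent_classes L)"
proof -
  let ?X = "{p. p \<noteq> (0,0,0) \<and> mult L p = 3 \<and> \<not> mixed L p}"
  have X: "p \<noteq> (0,0,0) \<and> 2 \<le> mult L p" if "p \<in> ?X" for p using that by simp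
  have eq: "nonmixed_triple_points L = proj_pt ` ?X"
    by (auto simp only: nonmixed_triple_points_def image_def)
  show "finite (nonmixed_triple_points L)"
    unfolding eq by (rule finite_points_if_lines_through(1)[OF X])
  have "card (nonmixed_triple_points L) = card (lines_through L ` ?X)"
    unfolding eq by (rule finite_points_if_lines_through(2)[OF X])
  then show "card (nonmixed_triple_points L) = card (concurrent_classes L)"
    unfolding nonmixed_triple_points_image
    using card_image[OF inj_on_subset[OF inj_class_block subset_UNIV]] by simp
qed

lemma card_mpoints_3: "card (mpoints L 3) = 9 + card (concurrent_classes L)"
proof -
  have "mpoints L 3 = mixed_points L \<union> nonmixed_triple_points L"
    unfolding mpoints_def mixed_points_def nonmixed_triple_points_def using mult_mixed by blast
  moreover have "mixed_points L \<inter> nonmixed_triple_points L = {}"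
  proof -
    \<comment> \<open>Being mixed is invariant under scaling of the representative, so no projective
      point is of both kinds.\<close>
    have False if pq: "mixed L p" "\<not> mixed L q" "proj_pt p = proj_pt q" for p q
    proof -
      obtain c where "c \<noteq> 0" "p = smul3 c q" using proj_pt_eqD[OF pq(3)] by blast
      then have "lines_through L p = lines_through L q" by (simp add: lines_through_smul3)
      then show False using pq(1,2) by (simp add: mixed_iff_lines_through)
    qed
    then show ?thesis unfolding mixed_points_def nonmixed_triple_points_def by blast
  qed
  ultimately show ?thesis
    using card_Un_disjoint[OF finite_mixed_points nonmixed_triple_points_finite_card(1)]
      card_mixed_points nonmixed_triple_points_finite_card(2) by simp
qed

lemma class_triple_points_card:
  assumes "c < 3"
  shows "c \<in> concurrent_classes L \<Longrightarrow> card (class_triple_points L c) = 1"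
    and "c \<notin> concurrent_classes L \<Longrightarrow> class_triple_points L c = {}"
proof -
  let ?X = "{p. p \<noteq> (0,0,0) \<and> mult L p = 3 \<and> lines_through L p = {c} \<times> {0..<3}}"
  have X: "p \<noteq> (0,0,0) \<and> 2 \<le> mult L p" if "p \<in> ?X" for p using that by simp
  have eq: "class_triple_points L c = proj_pt ` ?X"
    by (auto simp only: class_triple_points_def image_def)
  have sub: "{c} \<times> {0..<3} \<subseteq> idx" using assms by auto
  show "card (class_triple_points L c) = 1" if c: "c \<in> concurrent_classes L"
  proof -
    obtain p where p: "p \<noteq> (0,0,0)" "lines_through L p = {c} \<times> {0..<3}" using class_point[OF c] by blast
    then have "mult L p = 3" by (simp add: mult_def)
    then have "p \<in> ?X" using p by simp
    then have "lines_through L ` ?X = {{c} \<times> {0..<3}}" by blast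
    then have "card (lines_through L ` ?X) = 1" by (simp only: is_singletonI is_singleton_altdef[symmetric])
    then show ?thesis unfolding eq using finite_points_if_lines_through(2)[OF X] by (rule trans[rotated])
  qed
  show "class_triple_points L c = {}" if "c \<notin> concurrent_classes L"
  proof -
    have "\<not> concurrent L ({c} \<times> {0..<3})" using that assms by (simp add: concurrent_classes_def)
    then have "?X = {}" using concurrent_iff_lines_through[OF sub] by blast
    then show ?thesis unfolding eq by simp
  qed
qed

text \<open>Two lines of one class meet in a double point unless the third line of the class passes
  through their intersection; in a concurrent class every pair meets at the centre, which is
  triple.\<close>

lemma mult_2_lines_through_image:
  "lines_through L ` {p. p \<noteq> (0,0,0) \<and> mult L p = 2}
    = (\<Union>c\<in>{..<3} - concurrent_classes L. {S. S \<subseteq> {c} \<times> {0..<3} \<and> card S = 2})" (is "?A = ?B")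
proof
  show "?A \<subseteq> ?B"
  proof
    fix S assume "S \<in> ?A"
    then obtain p where p: "p \<noteq> (0,0,0)" "card (lines_through L p) = 2" "S = lines_through L p"
      unfolding mult_def by blast
    have "\<not> mixed L p" using mult_mixed[OF p(1)] p(2) by (auto simp: mult_def)
    then obtain c where c: "c < 3" "lines_through L p \<subseteq> {c} \<times> {0..<3}"
      using nonmixed_obtain_class[OF p(1)] by blast
    have "c \<notin> concurrent_classes L"
    proof
      assume "c \<in> concurrent_classes L"
      then obtain q where q: "q \<noteq> (0,0,0)" "lines_through L q = {c} \<times> {0..<3}"
        using class_point by blast
      obtain a b where ab: "a \<in> lines_through L p" "b \<in> lines_through L p" "a \<noteq> b"
        using two_elements_of_card_ge_2[OF eq_imp_le[OF p(2)[symmetric]]] .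
      moreover have "a \<in> lines_through L q" "b \<in> lines_through L q" using ab c(2) q(2) by blast+
      ultimately have "lines_through L p = lines_through L q"
        using lines_through_eq_if_two_common[OF p(1) q(1)] by blast
      then show False using p(2) q(2) by simp
    qed
    then show "S \<in> ?B" using c p by blast
  qed
  show "?B \<subseteq> ?A"
  proof
    fix S assume "S \<in> ?B"
    then obtain c where c: "c < 3" "c \<notin> concurrent_classes L" "S \<subseteq> {c} \<times> {0..<3}" "card S = 2"
      by blast
    then obtain a b where ab: "S = {a,b}" "a \<noteq> b" by (auto simp: card_2_iff)
    have sub: "{c} \<times> {0..<3} \<subseteq> idx" using c(1) by auto
    then obtain p where p: "p \<noteq> (0,0,0)" "a \<in> lines_through L p" "b \<in> lines_through L p"
      using meet_point[of a b] ab c(3) by blast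
    obtain i j where ij: "a = (c,i)" "b = (c,j)" using ab c(3) by auto
    have nm: "\<not> mixed L p"
      using not_mixed_if_class_subset[OF p(1), of c i j] p ij ab(2) by auto
    have "mult L p \<noteq> 3"
    proof
      assume "mult L p = 3"
      then obtain d where d: "lines_through L p = {d} \<times> {0..<3}"
        using mult_nonmixed_eq_3_iff[OF p(1) nm] by blast
      then have "d = c" using p(2) ij(1) by auto
      then have "concurrent L ({c} \<times> {0..<3})"
        using concurrent_iff_lines_through[OF sub] p(1) d by blast
      then show False using c(1,2) by (simp add: concurrent_classes_def)
    qed
    moreover have "card S \<le> card (lines_through L p)"
      using p ab by (intro card_mono) auto
    ultimately have m: "mult L p = 2" using c(4) mult_le_3[OF p(1)] by (auto simp: mult_def)
    have "S = lines_through L p"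
      using p ab m c(4) by (intro card_subset_eq) (auto simp: mult_def)
    then show "S \<in> ?A" using p(1) m by blast
  qed
qed

lemma card_mpoints_2:
  "finite (mpoints L 2)" "card (mpoints L 2) = 3 * (3 - card (concurrent_classes L))"
proof -
  let ?X = "{p. p \<noteq> (0,0,0) \<and> mult L p = 2}"
  have X: "p \<noteq> (0,0,0) \<and> 2 \<le> mult L p" if "p \<in> ?X" for p using that by simp
  have eq: "mpoints L 2 = proj_pt ` ?X" by (auto simp only: mpoints_def image_def)
  show "finite (mpoints L 2)" unfolding eq by (rule finite_points_if_lines_through(1)[OF X])
  have sub: "concurrent_classes L \<subseteq> {..<3}" by (auto simp: concurrent_classes_def)
  have "card (mpoints L 2) = card (lines_through L ` ?X)"
    unfolding eq by (rule finite_points_if_lines_through(2)[OF X])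
  also have "\<dots> = (\<Sum>c\<in>{..<3} - concurrent_classes L. card {S. S \<subseteq> {c} \<times> {0..<3::nat} \<and> card S = 2})"
    unfolding mult_2_lines_through_image
  proof (rule card_UN_disjoint)
    show "\<forall>c\<in>{..<3} - concurrent_classes L. finite {S. S \<subseteq> {c} \<times> {0..<3::nat} \<and> card S = 2}"
      by simp
    show "\<forall>c\<in>{..<3} - concurrent_classes L. \<forall>d\<in>{..<3} - concurrent_classes L. c \<noteq> d \<longrightarrow>
      {S. S \<subseteq> {c} \<times> {0..<3::nat} \<and> card S = 2} \<inter> {S. S \<subseteq> {d} \<times> {0..<3} \<and> card S = 2} = {}"
    proof (intro ballI impI)
      fix c d :: nat assume "c \<noteq> d"
      then have "({c} \<times> {0..<3::nat}) \<inter> ({d} \<times> {0..<3}) = {}" by auto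
      moreover have "S \<noteq> {}" if "card S = 2" for S :: "(nat \<times> nat) set" using that by auto
      ultimately show "{S. S \<subseteq> {c} \<times> {0..<3::nat} \<and> card S = 2} \<inter> {S. S \<subseteq> {d} \<times> {0..<3} \<and> card S = 2} = {}"
        by blast
    qed
  qed simp
  \<comment> \<open>Each class without a centre contributes its 3 pairs of lines.\<close>
  also have "\<dots> = (\<Sum>c\<in>{..<3} - concurrent_classes L. 3)"
    by (intro sum.cong) (simp_all add: n_subsets numeral_eq_Suc)
  also have "\<dots> = 3 * (3 - card (concurrent_classes L))"
    using sub by (simp add: card_Diff_subset finite_concurrent_classes)
  finally show "card (mpoints L 2) = 3 * (3 - card (concurrent_classes L))" .
qed

section \<open>The possible numbers of concurrent classes\<close>

lemma third_class_concurrent: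
  assumes c: "c1 \<in> concurrent_classes L" "c2 \<in> concurrent_classes L" "c1 \<noteq> c2"
    and c3: "c3 < 3" "c3 \<noteq> c1" "c3 \<noteq> c2"
  shows "c3 \<in> concurrent_classes L"
proof -
  have lt: "c1 < 3" "c2 < 3" using c by (auto simp: concurrent_classes_def)
  obtain p1 where p1: "p1 \<noteq> (0,0,0)" "lines_through L p1 = {c1} \<times> {0..<3}"
    using class_point[OF c(1)] by blast
  obtain p2 where p2: "p2 \<noteq> (0,0,0)" "lines_through L p2 = {c2} \<times> {0..<3}"
    using class_point[OF c(2)] by blast
  have on: "dot3 p (L (d,i)) = 0 \<longleftrightarrow> (d,i) \<in> lines_through L p" if "d < 3" "i < 3" for p d i
    using that by (simp add: lines_through_def incid_iff_dot3)
  \<comment> \<open>The index of the line of class \<open>c2\<close> through the intersection of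
    line \<open>k\<close> of class \<open>c3\<close> with line \<open>i\<close> of class
    \<open>c1\<close>; the net axiom makes it unique.\<close>
  define \<sigma> where "\<sigma> k i = (THE j. \<exists>p. p \<noteq> (0,0,0) \<and> (c3,k) \<in> lines_through L p
    \<and> (c1,i) \<in> lines_through L p \<and> (c2,j) \<in> lines_through L p)" for k i
  have \<sigma>: "\<exists>p. p \<noteq> (0,0,0) \<and> (c3,k) \<in> lines_through L p
      \<and> (c1,i) \<in> lines_through L p \<and> (c2,\<sigma> k i) \<in> lines_through L p" if ki: "k < 3" "i < 3" for k i
  proof -
    obtain p where p: "p \<noteq> (0,0,0)" "(c3,k) \<in> lines_through L p" "(c1,i) \<in> lines_through L p"
      using meet_point[of "(c3,k)" "(c1,i)"] ki lt c3 by auto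
    obtain j where j: "(c2,j) \<in> lines_through L p" "\<And>j'. (c2,j') \<in> lines_through L p \<Longrightarrow> j' = j"
      using lines_through_two_classes[OF p _ lt(2)] c3(2) by auto
    have "\<sigma> k i = j"
      unfolding \<sigma>_def
    proof (rule the_equality)
      show "\<exists>p. p \<noteq> (0,0,0) \<and> (c3,k) \<in> lines_through L p
        \<and> (c1,i) \<in> lines_through L p \<and> (c2,j) \<in> lines_through L p" using p j(1) by blast
      fix j' assume "\<exists>p. p \<noteq> (0,0,0) \<and> (c3,k) \<in> lines_through L p
        \<and> (c1,i) \<in> lines_through L p \<and> (c2,j') \<in> lines_through L p"
      then obtain q where q: "q \<noteq> (0,0,0)" "(c3,k) \<in> lines_through L q"
        "(c1,i) \<in> lines_through L q" "(c2,j') \<in> lines_through L q" by blast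
      have "lines_through L q = lines_through L p"
        using lines_through_eq_if_two_common[OF q(1) p(1), of "(c3,k)" "(c1,i)"] p q c3(2) by simp
      then show "j' = j" using q(4) j(2) by blast
    qed
    then show ?thesis using p j(1) by blast
  qed
  have det: "det3 (L (c3,0)) (L (c3,1)) (L (c3,2)) = 0"
  proof (rule two_pencils_force_third[where A = "\<lambda>i. L (c1,i)" and B = "\<lambda>j. L (c2,j)"
        and C = "\<lambda>k. L (c3,k)" and \<sigma> = \<sigma> and ?p1.0 = p1 and ?p2.0 = p2])
    \<comment> \<open>The centre of a class lies on the lines of that class and on no others, which
      gives both the vanishing and the nonvanishing values.\<close>
    show "dot3 p1 (L (c1,i)) = 0" "dot3 p2 (L (c1,i)) \<noteq> 0"
      "dot3 p2 (L (c2,i)) = 0" "dot3 p1 (L (c2,i)) \<noteq> 0" if "i < 3" for i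
      using on lt that p1(2) p2(2) c(3) by auto
    show "cross3 (L (c1,i)) (L (c2,j)) \<noteq> (0,0,0)" if "i < 3" "j < 3" for i j
      using cross3_lines_nonzero that lt c(3) by auto
    show "det3 (L (c1,i)) (L (c2, \<sigma> k i)) (L (c3,k)) = 0" if "i < 3" "k < 3" for i k
      using \<sigma>[OF that(2,1)] det3_eq_0_if_common_point unfolding lines_through_def by blast
    show "bij_betw (\<sigma> k) {..<3} {..<3}" if k: "k < 3" for k
    proof -
      \<comment> \<open>If two lines of class \<open>c1\<close> had the same image, they would pass
        through the same mixed point, the intersection of line \<open>k\<close> of class
        \<open>c3\<close> with the common line of class \<open>c2\<close>.\<close>
      have "inj_on (\<sigma> k) {..<3}"
      proof (rule inj_onI)
        fix i i' assume i: "i \<in> {..<3}" "i' \<in> {..<3}" and eq: "\<sigma> k i = \<sigma> k i'"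
        obtain p where p: "p \<noteq> (0,0,0)" "(c3,k) \<in> lines_through L p"
          "(c1,i) \<in> lines_through L p" "(c2,\<sigma> k i) \<in> lines_through L p" using \<sigma>[of k i] k i by auto
        obtain q where q: "q \<noteq> (0,0,0)" "(c3,k) \<in> lines_through L q"
          "(c1,i') \<in> lines_through L q" "(c2,\<sigma> k i) \<in> lines_through L q" using \<sigma>[of k i'] k i eq by auto
        have "lines_through L q = lines_through L p"
          using lines_through_eq_if_two_common[OF q(1) p(1), of "(c3,k)" "(c2,\<sigma> k i)"] p q c3(3) by simp
        then have "(c1,i') \<in> lines_through L p" using q(3) by simp
        then show "i = i'"
          using lines_through_two_classes[OF p(1,2,3) _ lt(1)] c3(2) p(3) by auto
      qed
      moreover have "\<sigma> k ` {..<3} \<subseteq> {..<3}"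
      proof (rule image_subsetI)
        fix i :: nat assume "i \<in> {..<3}"
        then show "\<sigma> k i \<in> {..<3}" using \<sigma>[of k i] k by (auto simp: lines_through_def)
      qed
      ultimately show ?thesis
        by (simp add: bij_betw_def endo_inj_surj)
    qed
  qed
  have "cross3 (L (c3,0)) (L (c3,1)) \<noteq> (0,0,0)"
    using c3(1) by (intro cross3_lines_nonzero) simp_all
  then obtain p where p: "p \<noteq> (0,0,0)" "incid p (L (c3,0))" "incid p (L (c3,1))" "incid p (L (c3,2))"
    using det3_eq_0_imp_common_point[OF det] by blast
  have "incid p (L (c3,j))" if "j < 3" for j
    using that p(2-4) all_less_3[of "\<lambda>j. incid p (L (c3,j))"] by blast
  then have "\<forall>a\<in>{c3} \<times> {0..<3}. incid p (L a)" by simp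
  then show ?thesis using p(1) c3(1) unfolding concurrent_classes_def concurrent_def by blast
qed

lemma card_concurrent_classes: "card (concurrent_classes L) \<in> {0,1,3}"
proof -
  have sub: "concurrent_classes L \<subseteq> {..<3}" by (auto simp: concurrent_classes_def)
  have "card (concurrent_classes L) \<noteq> 2"
  proof
    assume two: "card (concurrent_classes L) = 2"
    then obtain a b where ab: "concurrent_classes L = {a,b}" "a \<noteq> b" by (auto simp: card_2_iff)
    have "card ({..<3} - concurrent_classes L) = 1"
      using sub two by (simp add: card_Diff_subset finite_concurrent_classes)
    then obtain d where "{..<3} - concurrent_classes L = {d}" by (auto simp: card_1_singleton_iff)
    then have "d < 3" "d \<notin> concurrent_classes L" by auto
    then show False using third_class_concurrent[of a b d] ab by auto
  qed
  moreover have "card (concurrent_classes L) \<le> card {..<3::nat}" using sub by (intro card_mono) auto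
  ultimately show ?thesis by auto
qed

section \<open>Concurrency in a net from concurrent classes and mixed triples\<close>

text \<open>Rows, columns and symbols of the Latin square of mixed points are the three classes.
  Leaving the classes of \<open>a\<close>, \<open>b\<close> and \<open>c\<close> free lets this one
  statement supply all three uniqueness properties of the square.\<close>

lemma two_classes_determine_third:
  assumes "a \<in> idx" "b \<in> idx" "fst a \<noteq> fst b" "c < 3"
  shows "\<exists>!k. k < 3 \<and> concurrent L {a, b, (c,k)}"
proof -
  obtain p where p: "p \<noteq> (0,0,0)" "a \<in> lines_through L p" "b \<in> lines_through L p"
    using meet_point[of a b] assms by auto
  obtain k where k: "(c,k) \<in> lines_through L p" "\<And>l. (c,l) \<in> lines_through L p \<Longrightarrow> l = k"
    using lines_through_two_classes[OF p assms(3,4)] by auto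
  show ?thesis
  proof (rule ex1I[of _ k])
    have lt: "k < 3" using k(1) by (simp add: lines_through_def)
    have "{a, b, (c,k)} \<subseteq> idx" using assms lt by simp
    then have "concurrent L {a, b, (c,k)}"
      using concurrent_iff_lines_through[of "{a, b, (c,k)}" L] p k(1) by blast
    then show "k < 3 \<and> concurrent L {a, b, (c,k)}" using lt by blast
    fix l assume l: "l < 3 \<and> concurrent L {a, b, (c,l)}"
    then have "{a, b, (c,l)} \<subseteq> idx" using assms by simp
    then obtain q where q: "q \<noteq> (0,0,0)" "{a, b, (c,l)} \<subseteq> lines_through L q"
      using concurrent_iff_lines_through[of "{a, b, (c,l)}" L] l by blast
    have "a \<noteq> b" using assms(3) by blast
    then have "lines_through L q = lines_through L p"
      using lines_through_eq_if_two_common[OF q(1) p(1), of a b] q(2) p(2,3) by blast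
    then show "l = k" using q(2) k(2) by blast
  qed
qed

lemma concurrent_mono: "concurrent M T \<Longrightarrow> S \<subseteq> T \<Longrightarrow> concurrent M S"
  unfolding concurrent_def by blast

text \<open>The right-hand side mentions \<open>L\<close> only through its concurrent classes and
  its mixed triples, so two nets agreeing in these data have the same concurrent sets.\<close>

lemma concurrent_in_net_iff:
  assumes "S \<subseteq> idx"
  shows "concurrent L S \<longleftrightarrow>
    (\<exists>c<3. S \<subseteq> {c} \<times> {0..<3} \<and> (c \<in> concurrent_classes L \<or> S \<noteq> {c} \<times> {0..<3})) \<or>
    (\<exists>i<3. \<exists>j<3. \<exists>k<3. concurrent L {(0,i),(1,j),(2,k)} \<and> S \<subseteq> {(0,i),(1,j),(2,k)})"
    (is "_ \<longleftrightarrow> ?A \<or> ?B")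
proof
  assume conc: "concurrent L S"
  then obtain p where p: "p \<noteq> (0,0,0)" "S \<subseteq> lines_through L p"
    using concurrent_iff_lines_through[OF assms] by blast
  show "?A \<or> ?B"
  proof (cases "mixed L p")
    case True
    obtain i j k where ijk: "i < 3" "j < 3" "k < 3" "lines_through L p = {(0,i),(1,j),(2,k)}"
      using mixed_obtain[OF p(1) True] .
    have "{(0,i),(1,j),(2,k)} \<subseteq> idx" using ijk(1-3) by simp
    then have "concurrent L {(0,i),(1,j),(2,k)}"
      using concurrent_iff_lines_through[of "{(0,i),(1,j),(2,k)}" L] p(1) ijk(4) by blast
    moreover have "S \<subseteq> {(0,i),(1,j),(2,k)}" using p(2) ijk(4) by simp
    ultimately have ?B using ijk(1-3) by blast
    then show ?thesis ..
  next
    case False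
    obtain c where c: "c < 3" "lines_through L p \<subseteq> {c} \<times> {0..<3}"
      using nonmixed_obtain_class[OF p(1) False] .
    have "c \<in> concurrent_classes L" if "S = {c} \<times> {0..<3}"
      using conc c(1) that by (simp add: concurrent_classes_def)
    moreover have "S \<subseteq> {c} \<times> {0..<3}" using c(2) p(2) by (rule order_trans[rotated])
    ultimately have ?A using c(1) by blast
    then show ?thesis ..
  qed
next
  assume "?A \<or> ?B"
  then show "concurrent L S"
  proof
    assume ?A
    then obtain c where c: "c < 3" "S \<subseteq> {c} \<times> {0..<3}"
      "c \<in> concurrent_classes L \<or> S \<noteq> {c} \<times> {0..<3}" by blast
    from c(3) show ?thesis
    proof
      assume "c \<in> concurrent_classes L"
      then have "concurrent L ({c} \<times> {0..<3})" by (simp add: concurrent_classes_def)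
      then show ?thesis using c(2) by (rule concurrent_mono)
    next
      assume "S \<noteq> {c} \<times> {0..<3}"
      \<comment> \<open>A proper subset of a class misses some line \<open>m\<close>, and the other
        two lines of the class meet.\<close>
      then obtain x where x: "x \<in> {c} \<times> {0..<3}" "x \<notin> S" using c(2) by blast
      obtain m where m: "m < 3" "(c,m) \<notin> S" using x by auto
      have "card ({0..<3} - {m}) = 2" using m(1) by simp
      then obtain x y where xy: "{0..<3} - {m} = {x,y}" "x \<noteq> y" by (auto simp: card_2_iff)
      have "x \<in> {0..<3} - {m}" "y \<in> {0..<3} - {m}" by (simp_all only: xy(1) insertI1 insertI2)
      then have lt: "x < 3" "y < 3" by simp_all
      obtain p where p: "p \<noteq> (0,0,0)" "(c,x) \<in> lines_through L p" "(c,y) \<in> lines_through L p"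
        using meet_point[of "(c,x)" "(c,y)"] c(1) xy(2) lt by auto
      have "S \<subseteq> {(c,x),(c,y)}"
      proof
        fix a assume a: "a \<in> S"
        obtain l where l: "a = (c,l)" "l \<in> {0..<3}" using a c(2) by blast
        then have "l \<in> {0..<3} - {m}" using a m(2) by blast
        then have "l \<in> {x,y}" unfolding xy(1) .
        then show "a \<in> {(c,x),(c,y)}" using l(1) by blast
      qed
      then have "S \<subseteq> lines_through L p" using p(2,3) by blast
      then show ?thesis
        using concurrent_iff_lines_through[OF assms] p(1) by blast
    qed
  next
    assume ?B
    then obtain i j k where "concurrent L {(0,i),(1,j),(2,k)}" "S \<subseteq> {(0,i),(1,j),(2,k)}" by blast
    then show ?thesis by (rule concurrent_mono)
  qed
qed

end

section \<open>Standard nets and relabelling\<close>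

text \<open>The normal form of a net with \<open>n\<close> concurrent classes: these come first, and
  the mixed triples form the addition table of the integers modulo 3, written symmetrically in the
  three classes.\<close>

definition standard_net :: "(nat \<times> nat \<Rightarrow> cvec) \<Rightarrow> nat \<Rightarrow> bool" where
  "standard_net L n \<longleftrightarrow> net33 L \<and> concurrent_classes L = {..<n} \<and>
     (\<forall>i<3. \<forall>j<3. \<forall>k<3. concurrent L {(0,i),(1,j),(2,k)} \<longleftrightarrow> (i + j + k) mod 3 = 0)"

lemma standard_nets_same_concurrency:
  assumes "standard_net L n" "standard_net M n" "S \<subseteq> idx"
  shows "concurrent L S \<longleftrightarrow> concurrent M S"
proof -
  have L: "net33 L" "concurrent_classes L = {..<n}" and M: "net33 M" "concurrent_classes M = {..<n}"
    using assms(1,2) by (simp_all only: standard_net_def)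
  have eq: "concurrent L {(0,i),(1,j),(2,k)} \<longleftrightarrow> concurrent M {(0,i),(1,j),(2,k)}"
    if "i < 3" "j < 3" "k < 3" for i j k
    using assms(1,2) that by (simp only: standard_net_def)
  show ?thesis
    unfolding concurrent_in_net_iff[OF L(1) assms(3)] concurrent_in_net_iff[OF M(1) assms(3)] L(2) M(2)
    by (intro disj_cong refl ex_cong1 conj_cong eq)
qed

lemma concurrent_comp: "concurrent (L \<circ> \<sigma>) S \<longleftrightarrow> concurrent L (\<sigma> ` S)"
  unfolding concurrent_def by simp

text \<open>Both arrangements are compared with a common normal form: the isomorphism undoes
  \<open>\<sigma>\<close> and then applies \<open>\<tau>\<close>.\<close>

lemma lattice_iso_if_standard:
  assumes "standard_net (L \<circ> \<sigma>) n" "bij_betw \<sigma> idx idx"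
    and "standard_net (M \<circ> \<tau>) n" "bij_betw \<tau> idx idx"
  shows "lattice_iso L M"
  unfolding lattice_iso_def
proof (intro exI conjI allI impI)
  let ?i = "inv_into idx \<sigma>"
  have inv: "bij_betw ?i idx idx" by (rule bij_betw_inv_into[OF assms(2)])
  then show "bij_betw (\<tau> \<circ> ?i) idx idx" using assms(4) by (rule bij_betw_trans)
  fix S assume S: "S \<subseteq> idx"
  then have T: "?i ` S \<subseteq> idx" using inv by (auto simp: bij_betw_def)
  have "\<sigma> ` ?i ` S = S" using S assms(2) by (simp add: bij_betw_def image_inv_into_cancel)
  then have "concurrent L S \<longleftrightarrow> concurrent (L \<circ> \<sigma>) (?i ` S)" by (simp add: concurrent_comp)
  also have "\<dots> \<longleftrightarrow> concurrent (M \<circ> \<tau>) (?i ` S)"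
    by (rule standard_nets_same_concurrency[OF assms(1,3) T])
  also have "\<dots> \<longleftrightarrow> concurrent M ((\<tau> \<circ> ?i) ` S)" by (simp add: concurrent_comp image_comp)
  finally show "concurrent L S \<longleftrightarrow> concurrent M ((\<tau> \<circ> ?i) ` S)" .
qed

text \<open>The index maps that respect the partition: classes are permuted by
  \<open>\<rho>\<close>, and the lines within a class by a permutation chosen according to the
  source class.\<close>

definition relabel :: "(nat \<Rightarrow> nat) \<Rightarrow> (nat \<Rightarrow> nat \<Rightarrow> nat) \<Rightarrow> nat \<times> nat \<Rightarrow> nat \<times> nat" where
  "relabel \<rho> \<pi> = (\<lambda>(c,i). (\<rho> c, \<pi> c i))"

context
  fixes \<rho> :: "nat \<Rightarrow> nat" and \<pi> :: "nat \<Rightarrow> nat \<Rightarrow> nat"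
  assumes \<rho>: "bij_betw \<rho> {..<3} {..<3}" and \<pi>: "\<And>c. c < 3 \<Longrightarrow> bij_betw (\<pi> c) {..<3} {..<3}"
begin

lemma relabel_less_3: "c < 3 \<Longrightarrow> \<rho> c < 3" "c < 3 \<Longrightarrow> i < 3 \<Longrightarrow> \<pi> c i < 3"
  using \<rho> \<pi>[of c] by (auto simp: bij_betw_def)

lemma bij_betw_relabel: "bij_betw (relabel \<rho> \<pi>) idx idx"
proof -
  have "inj_on (relabel \<rho> \<pi>) idx"
  proof (rule inj_onI)
    fix a b assume ab: "a \<in> idx" "b \<in> idx" "relabel \<rho> \<pi> a = relabel \<rho> \<pi> b"
    obtain c i d j where e: "a = (c,i)" "b = (d,j)" by (metis prod.exhaust)
    have lt: "c < 3" "i < 3" "d < 3" "j < 3" using ab e by auto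
    have eq: "\<rho> c = \<rho> d" "\<pi> c i = \<pi> d j" using ab(3) by (auto simp: e relabel_def)
    have "c = d" using \<rho> eq(1) lt by (auto simp: bij_betw_def inj_on_def)
    moreover from this have "i = j" using \<pi>[OF lt(1)] eq(2) lt by (auto simp: bij_betw_def inj_on_def)
    ultimately show "a = b" using e by simp
  qed
  moreover have "relabel \<rho> \<pi> ` idx \<subseteq> idx"
    using relabel_less_3 by (auto simp: relabel_def)
  moreover have "finite idx" by (simp add: idx_def)
  ultimately show ?thesis by (simp add: bij_betw_def endo_inj_surj)
qed

lemma net33_relabel:
  assumes "net33 L"
  shows "net33 (L \<circ> relabel \<rho> \<pi>)"
  unfolding net33_def
proof (intro conjI allI impI ballI)
  have arr: "arrangement9 L" using assms by (simp add: net33_def)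
  have mem: "relabel \<rho> \<pi> a \<in> idx" if "a \<in> idx" for a
    using bij_betw_relabel that by (auto simp only: bij_betw_def)
  have inj: "relabel \<rho> \<pi> a \<noteq> relabel \<rho> \<pi> b" if "a \<in> idx" "b \<in> idx" "a \<noteq> b" for a b
    using bij_betw_relabel that by (auto simp only: bij_betw_def inj_on_def)
  show "arrangement9 (L \<circ> relabel \<rho> \<pi>)"
    using arr mem inj unfolding arrangement9_def o_def by blast
  fix p a b k
  assume p: "p \<noteq> (0,0,0)" and ab: "a \<in> idx" "b \<in> idx" and k: "k < (3::nat)"
    and inc: "fst a \<noteq> fst b \<and> incid p ((L \<circ> relabel \<rho> \<pi>) a) \<and> incid p ((L \<circ> relabel \<rho> \<pi>) b)"
  have "fst (relabel \<rho> \<pi> a) \<noteq> fst (relabel \<rho> \<pi> b)"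
  proof -
    have "fst a < 3" "fst b < 3" using ab by (auto simp: idx_def)
    then have "\<rho> (fst a) \<noteq> \<rho> (fst b)" using \<rho> inc by (auto simp: bij_betw_def inj_on_def)
    then show ?thesis by (simp add: relabel_def split_beta)
  qed
  then have 1: "card {j. j < 3 \<and> incid p (L (\<rho> k, j))} = 1"
    using assms p mem[OF ab(1)] mem[OF ab(2)] inc relabel_less_3(1)[OF k]
    unfolding net33_def o_def by blast
  \<comment> \<open>The net axiom for the new labels is the old one for class
    \<open>\<rho> k\<close>, transported along the permutation of its lines.\<close>
  have "bij_betw (\<pi> k) {j. j < 3 \<and> incid p (L (\<rho> k, \<pi> k j))} {j. j < 3 \<and> incid p (L (\<rho> k, j))}"
    unfolding bij_betw_def
  proof
    show "inj_on (\<pi> k) {j. j < 3 \<and> incid p (L (\<rho> k, \<pi> k j))}"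
      using \<pi>[OF k] by (auto simp: bij_betw_def inj_on_def)
    have "\<exists>j<3. \<pi> k j = i" if "i < 3" for i
    proof -
      have "i \<in> \<pi> k ` {..<3}" using \<pi>[OF k] that by (simp add: bij_betw_def)
      then show ?thesis by auto
    qed
    then show "\<pi> k ` {j. j < 3 \<and> incid p (L (\<rho> k, \<pi> k j))} = {j. j < 3 \<and> incid p (L (\<rho> k, j))}"
      using relabel_less_3(2)[OF k] by blast
  qed
  from bij_betw_same_card[OF this] 1
  show "card {j. j < 3 \<and> incid p ((L \<circ> relabel \<rho> \<pi>) (k, j))} = 1"
    by (simp add: relabel_def)
qed

lemma concurrent_classes_relabel:
  "concurrent_classes (L \<circ> relabel \<rho> \<pi>) = {c. c < 3 \<and> \<rho> c \<in> concurrent_classes L}"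
proof -
  have "relabel \<rho> \<pi> ` ({c} \<times> {0..<3}) = {\<rho> c} \<times> {0..<3}" if "c < 3" for c
  proof -
    have "relabel \<rho> \<pi> ` ({c} \<times> {0..<3}) = {\<rho> c} \<times> \<pi> c ` {0..<3}"
      by (auto simp: relabel_def)
    then show ?thesis using \<pi>[OF that] by (simp add: bij_betw_def lessThan_atLeast0)
  qed
  then show ?thesis
    using relabel_less_3(1) by (auto simp: concurrent_classes_def concurrent_comp)
qed

end

section \<open>Uniqueness of the Latin square of order 3\<close>

text \<open>Once the rows are ordered so that the first column repeats the first row, the other four
  entries are forced and the square is cyclic. Permuting rows by \<open>a\<close> and symbols by
  \<open>c\<close> therefore suffices; the columns keep their labels.\<close>

lemma latin_square_3_normal_form:
  fixes T :: "nat \<Rightarrow> nat \<Rightarrow> nat \<Rightarrow> bool"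
  assumes k: "\<And>i j. i < 3 \<Longrightarrow> j < 3 \<Longrightarrow> \<exists>!k. k < 3 \<and> T i j k"
    and j: "\<And>i k. i < 3 \<Longrightarrow> k < 3 \<Longrightarrow> \<exists>!j. j < 3 \<and> T i j k"
    and i: "\<And>j k. j < 3 \<Longrightarrow> k < 3 \<Longrightarrow> \<exists>!i. i < 3 \<and> T i j k"
  shows "\<exists>a c. bij_betw a {..<3} {..<3} \<and> bij_betw c {..<3} {..<3} \<and>
    (\<forall>i<3. \<forall>j<3. \<forall>k<3. T (a i) j (c k) \<longleftrightarrow> (i + j + k) mod 3 = 0)"
proof -
  define f where "f i j = (THE k. k < 3 \<and> T i j k)" for i j
  have f: "f i j < 3 \<and> T i j (f i j)" if "i < 3" "j < 3" for i j
    unfolding f_def by (rule theI'[OF k[OF that]])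
  have Tf: "T i j l \<longleftrightarrow> f i j = l" if "i < 3" "j < 3" "l < 3" for i j l
    using f[OF that(1,2)] k[OF that(1,2)] that(3) by blast
  have row: "f i j \<noteq> f i j'" if "i < 3" "j < 3" "j' < 3" "j \<noteq> j'" for i j j'
  proof
    assume "f i j = f i j'"
    then have "T i j (f i j)" "T i j' (f i j)" "f i j < 3"
      using f[OF that(1,2)] f[OF that(1,3)] by auto
    then show False using j[OF that(1), of "f i j"] that(2-4) by blast
  qed
  have col: "f i j \<noteq> f i' j" if "i < 3" "i' < 3" "j < 3" "i \<noteq> i'" for i i' j
  proof
    assume "f i j = f i' j"
    then have "T i j (f i j)" "T i' j (f i j)" "f i j < 3"
      using f[OF that(1,3)] f[OF that(2,3)] by auto
    then show False using i[OF that(3), of "f i j"] that(1,2,4) by blast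
  qed
  \<comment> \<open>The row whose entry in column 0 is the entry of row 0 in column
    \<open>i\<close>.\<close>
  define a where "a i = (THE r. r < 3 \<and> T r 0 (f 0 i))" for i
  have a: "a r < 3 \<and> f (a r) 0 = f 0 r" if "r < 3" for r
  proof -
    have "a r < 3 \<and> T (a r) 0 (f 0 r)"
      unfolding a_def using f[of 0 r] that by (intro theI'[OF i]) auto
    then show ?thesis using Tf[of "a r" 0 "f 0 r"] f[of 0 r] that by auto
  qed
  have a_inj: "a r \<noteq> a s" if "r < 3" "s < 3" "r \<noteq> s" for r s
    using a[OF that(1)] a[OF that(2)] row[of 0 r s] that by auto
  \<comment> \<open>The symbol is named by the negative of its column in row 0, which turns
    \<open>i + j\<close> equal to that column into \<open>i + j + k\<close> equal to 0. The outer
    \<open>mod\<close> sends 3 back to 0 when \<open>k\<close> is 0.\<close>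
  define c where "c k = f 0 ((3 - k) mod 3)" for k
  have g_inj: "f 0 r = f 0 s \<longleftrightarrow> r = s" if "r < 3" "s < 3" for r s
    using row[of 0 r s] that by auto
  have bij_a: "bij_betw a {..<3} {..<3}"
    using a a_inj by (intro bij_betw_imageI endo_inj_surj) (auto simp: inj_on_def)
  have "inj_on c {..<3}"
  proof (rule inj_onI)
    fix x y :: nat assume "x \<in> {..<3}" "y \<in> {..<3}" "c x = c y"
    moreover from this have "(3 - x) mod 3 = (3 - y) mod 3" using g_inj by (auto simp: c_def)
    moreover have "x = 0 \<or> x = 1 \<or> x = 2" "y = 0 \<or> y = 1 \<or> y = 2" using calculation by auto
    ultimately show "x = y" by auto
  qed
  then have bij_c: "bij_betw c {..<3} {..<3}"
    using f by (intro bij_betw_imageI endo_inj_surj) (auto simp: c_def)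
  have a0: "a 0 = 0"
  proof (rule ccontr)
    assume "a 0 \<noteq> 0"
    then show False using col[of "a 0" 0 0] a[of 0] by auto
  qed
  have onto: "v = f 0 0 \<or> v = f 0 1 \<or> v = f 0 2" if "v < 3" for v
  proof -
    have "f 0 0 < 3" "f 0 1 < 3" "f 0 2 < 3" "f 0 0 \<noteq> f 0 1" "f 0 0 \<noteq> f 0 2" "f 0 1 \<noteq> f 0 2"
      using f[of 0 0] f[of 0 1] f[of 0 2] g_inj[of 0 1] g_inj[of 0 2] g_inj[of 1 2] by auto
    then show ?thesis using that by linarith
  qed
  have a12: "a 1 < 3" "a 2 < 3" "a 1 \<noteq> 0" "a 2 \<noteq> 0" "f (a 1) 0 = f 0 1" "f (a 2) 0 = f 0 2"
    using a[of 1] a[of 2] a_inj[of 1 0] a_inj[of 2 0] a0 by auto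
  \<comment> \<open>Two symbols are excluded for each remaining entry. In row \<open>a 1\<close>,
    column 2 is settled before column 1, because only there do row and column exclude different
    symbols at once; row \<open>a 2\<close> starts with column 1 for the same reason.\<close>
  have f12: "f (a 1) 2 = f 0 0"
    using onto[of "f (a 1) 2"] f[of "a 1" 2] row[of "a 1" 2 0] col[of "a 1" 0 2] a12 by auto
  have f11: "f (a 1) 1 = f 0 2"
    using onto[of "f (a 1) 1"] f[of "a 1" 1] row[of "a 1" 1 0] row[of "a 1" 1 2] f12 a12 by auto
  have f21: "f (a 2) 1 = f 0 0"
    using onto[of "f (a 2) 1"] f[of "a 2" 1] row[of "a 2" 1 0] col[of "a 2" 0 1] a12 by auto
  have f22: "f (a 2) 2 = f 0 1"
    using onto[of "f (a 2) 2"] f[of "a 2" 2] row[of "a 2" 2 0] row[of "a 2" 2 1] f21 a12 by auto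
  have table: "f (a i) j = f 0 ((i + j) mod 3)" if "i < 3" "j < 3" for i j
  proof -
    have "i = 0 \<or> i = 1 \<or> i = 2" "j = 0 \<or> j = 1 \<or> j = 2" using that by auto
    then show ?thesis
      using f11 f12 f21 f22 a12(5,6) a0 by (elim disjE) (simp_all add: numeral_2_eq_2[symmetric])
  qed
  have "T (a i) j (c k) \<longleftrightarrow> (i + j + k) mod 3 = 0" if "i < 3" "j < 3" "k < 3" for i j k
  proof -
    have "c k < 3" using f[of 0 "(3 - k) mod 3"] by (simp add: c_def)
    then have "T (a i) j (c k) \<longleftrightarrow> f 0 ((i + j) mod 3) = f 0 ((3 - k) mod 3)"
      using Tf[of "a i" j "c k"] a[OF that(1)] that(2) table[OF that(1,2)] by (simp add: c_def)
    also have "\<dots> \<longleftrightarrow> (i + j) mod 3 = (3 - k) mod 3" by (intro g_inj) simp_all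
    also have "\<dots> \<longleftrightarrow> (i + j + k) mod 3 = 0"
    proof -
      have "i = 0 \<or> i = 1 \<or> i = 2" "j = 0 \<or> j = 1 \<or> j = 2" "k = 0 \<or> k = 1 \<or> k = 2"
        using that by auto
      then show ?thesis by (elim disjE) simp_all
    qed
    finally show ?thesis .
  qed
  then show ?thesis using bij_a bij_c by (intro exI[of _ a] exI[of _ c] conjI allI impI)
qed

text \<open>Two relabellings are composed: the first permutes classes to bring the concurrent ones
  to the front, the second permutes lines inside classes only and so leaves that arrangement of
  classes intact.\<close>

lemma net33_standardize:
  assumes "net33 L"
  obtains \<sigma> where "bij_betw \<sigma> idx idx" "standard_net (L \<circ> \<sigma>) (card (concurrent_classes L))"
proof -
  define n where "n = card (concurrent_classes L)"
  have sub: "concurrent_classes L \<subseteq> {..<3}" by (auto simp: concurrent_classes_def)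
  have n: "n \<in> {0,1,3}" unfolding n_def by (rule card_concurrent_classes[OF assms])
  obtain \<rho> where \<rho>: "bij_betw \<rho> {..<3} {..<3}" "{c. c < 3 \<and> \<rho> c \<in> concurrent_classes L} = {..<n}"
  proof (cases "n = 1")
    case True
    then obtain d where d: "concurrent_classes L = {d}" unfolding n_def by (auto simp: card_1_singleton_iff)
    then have "d < 3" using sub by auto
    \<comment> \<open>The transposition of 0 and \<open>d\<close> moves the only concurrent class to
      position 0. When none or all classes are concurrent, the identity will do.\<close>
    let ?\<rho> = "\<lambda>c. if c = 0 then d else if c = d then 0 else c"
    have "bij_betw ?\<rho> {..<3} {..<3}"
      using \<open>d < 3\<close> by (intro bij_betw_imageI endo_inj_surj) (auto simp: inj_on_def split: if_splits)
    moreover have "{c. c < 3 \<and> ?\<rho> c \<in> concurrent_classes L} = {..<n}" using d True by auto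
    ultimately show thesis by (rule that)
  next
    case False
    have cc: "concurrent_classes L = {..<n}"
    proof (cases "n = 0")
      case True
      then show ?thesis using finite_concurrent_classes[OF assms] by (simp add: n_def)
    next
      case n0: False
      then have "n = 3" using n False by simp
      then show ?thesis using card_subset_eq[OF _ sub] by (simp add: n_def)
    qed
    have "n \<le> 3" using n by auto
    then have "{c. c < 3 \<and> id c \<in> concurrent_classes L} = {..<n}" unfolding cc by auto
    then show thesis by (rule that[OF bij_betw_id])
  qed
  define M where "M = L \<circ> relabel \<rho> (\<lambda>_. id)"
  have M: "net33 M" "concurrent_classes M = {..<n}"
    unfolding M_def concurrent_classes_relabel[OF \<rho>(1) bij_betw_id] \<rho>(2)
    by (rule net33_relabel[OF \<rho>(1) bij_betw_id assms], rule refl)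
  have third: "\<exists>!k. k < 3 \<and> concurrent M {(0,i),(1,j),(2,k)}" if "i < 3" "j < 3" for i j
    by (rule two_classes_determine_third[OF M(1)]) (use that in simp_all)
  have swap: "{(0::nat,i),(2,k),(1,j)} = {(0,i),(1,j),(2,k)}" "{(1::nat,j),(2,k),(0,i)} = {(0,i),(1,j),(2,k)}"
    for i j k :: nat by blast+
  have second: "\<exists>!j. j < 3 \<and> concurrent M {(0,i),(1,j),(2,k)}" if "i < 3" "k < 3" for i k
    unfolding swap(1)[symmetric]
    by (rule two_classes_determine_third[OF M(1)]) (use that in simp_all)
  have first: "\<exists>!i. i < 3 \<and> concurrent M {(0,i),(1,j),(2,k)}" if "j < 3" "k < 3" for j k
    unfolding swap(2)[symmetric]
    by (rule two_classes_determine_third[OF M(1)]) (use that in simp_all)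
  have "\<exists>a c. bij_betw a {..<3} {..<3} \<and> bij_betw c {..<3} {..<3} \<and>
    (\<forall>i<3. \<forall>j<3. \<forall>k<3. concurrent M {(0, a i), (1, j), (2, c k)} \<longleftrightarrow> (i + j + k) mod 3 = 0)"
    by (rule latin_square_3_normal_form[of "\<lambda>i j k. concurrent M {(0,i),(1,j),(2,k)}"])
      (erule (1) third, erule (1) second, erule (1) first)
  then obtain a c where ac: "bij_betw a {..<3} {..<3}" "bij_betw c {..<3} {..<3}"
    "\<forall>i<3. \<forall>j<3. \<forall>k<3. concurrent M {(0, a i), (1, j), (2, c k)} \<longleftrightarrow> (i + j + k) mod 3 = 0"
    by (elim exE conjE)
  \<comment> \<open>Rows are class 0 and symbols are class 2; class 1 provides the columns, which
    the Latin square normal form does not move.\<close>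
  define \<pi> where "\<pi> d = (if d = 0 then a else if d = 1 then id else c)" for d :: nat
  have \<pi>: "bij_betw (\<pi> d) {..<3} {..<3}" for d using ac(1,2) by (simp add: \<pi>_def)
  have N: "net33 (M \<circ> relabel id \<pi>)" "concurrent_classes (M \<circ> relabel id \<pi>) = {..<n}"
  proof -
    show "net33 (M \<circ> relabel id \<pi>)" by (rule net33_relabel[OF bij_betw_id \<pi> M(1)])
    have "n \<le> 3" using n by auto
    then show "concurrent_classes (M \<circ> relabel id \<pi>) = {..<n}"
      unfolding concurrent_classes_relabel[OF bij_betw_id \<pi>] M(2) by auto
  qed
  have "concurrent (M \<circ> relabel id \<pi>) {(0,i),(1,j),(2,k)} \<longleftrightarrow> (i + j + k) mod 3 = 0"
    if "i < 3" "j < 3" "k < 3" for i j k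
    using ac(3)[rule_format, OF that] by (simp add: concurrent_comp relabel_def \<pi>_def)
  with N have "standard_net (M \<circ> relabel id \<pi>) n"
    unfolding standard_net_def by (intro conjI allI impI)
  then have "standard_net (L \<circ> (relabel \<rho> (\<lambda>_. id) \<circ> relabel id \<pi>)) n"
    by (simp add: M_def comp_assoc)
  moreover have "bij_betw (relabel \<rho> (\<lambda>_. id) \<circ> relabel id \<pi>) idx idx"
    using bij_betw_relabel[OF bij_betw_id \<pi>] bij_betw_relabel[OF \<rho>(1) bij_betw_id]
    by (rule bij_betw_trans)
  ultimately show thesis by (intro that[folded n_def])
qed

section \<open>A determinant criterion for standard nets\<close>

text \<open>Zero and proportional vectors are included: a single linear form in three variables
  already has a nonzero zero, such as \<open>(b, -a, 0)\<close>.\<close>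

lemma two_lines_meet: "\<exists>p. p \<noteq> (0,0,0) \<and> incid p u \<and> incid p v"
proof -
  have one: "\<exists>p. p \<noteq> (0,0,0) \<and> incid p w" for w
  proof (cases w rule: prod_cases3)
    case (fields a b c)
    show ?thesis
    proof (cases "a = 0")
      case True
      then have "(1,0,0) \<noteq> ((0,0,0)::cvec)" "incid (1,0,0) w" using fields by (simp_all add: incid_def)
      then show ?thesis by blast
    next
      case False
      then have "(b, -a, 0) \<noteq> (0,0,0)" "incid (b, -a, 0) w" using fields by (simp_all add: incid_def)
      then show ?thesis by blast
    qed
  qed
  show ?thesis
  proof (cases "cross3 u v = (0,0,0)")
    case False
    then show ?thesis using incid_cross3 by blast
  next
    case True
    show ?thesis
    proof (cases "u = (0,0,0)")
      case True
      obtain p where p: "p \<noteq> (0,0,0)" "incid p v" using one by blast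
      moreover have "incid p u" using True by (simp add: incid_def split: prod.splits)
      ultimately show ?thesis by blast
    next
      case False
      then obtain c where c: "v = smul3 c u" using True cross3_eq_0_imp_smul3 by blast
      obtain p where p: "p \<noteq> (0,0,0)" "incid p u" using one by blast
      then have "incid p v" unfolding c by (intro incid_smul3_right)
      then show ?thesis using p by blast
    qed
  qed
qed

text \<open>Degenerate vectors are covered on purpose, so that determinants can be interpreted
  before the lines of a model are known to be nonzero and distinct.\<close>

lemma det3_eq_0_iff_common_point:
  "det3 u v w = 0 \<longleftrightarrow> (\<exists>p. p \<noteq> (0,0,0) \<and> incid p u \<and> incid p v \<and> incid p w)"
proof
  assume det: "det3 u v w = 0"
  show "\<exists>p. p \<noteq> (0,0,0) \<and> incid p u \<and> incid p v \<and> incid p w"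
  proof (cases "cross3 u v = (0,0,0)")
    case False
    then show ?thesis by (rule det3_eq_0_imp_common_point[OF det])
  next
    case cross: True
    show ?thesis
    proof (cases "u = (0,0,0)")
      case True
      obtain p where "p \<noteq> (0,0,0)" "incid p v" "incid p w" using two_lines_meet by blast
      moreover have "incid p u" using True by (simp add: incid_def split: prod.splits)
      ultimately show ?thesis by blast
    next
      case False
      then obtain c where c: "v = smul3 c u" using cross cross3_eq_0_imp_smul3 by blast
      obtain p where p: "p \<noteq> (0,0,0)" "incid p u" "incid p w" using two_lines_meet by blast
      then have "incid p v" unfolding c by (intro incid_smul3_right)
      then show ?thesis using p by blast
    qed
  qed
next
  assume "\<exists>p. p \<noteq> (0,0,0) \<and> incid p u \<and> incid p v \<and> incid p w"
  then show "det3 u v w = 0" using det3_eq_0_if_common_point by blast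
qed

text \<open>A choice \<open>t\<close> of one line per class may be prescribed in two classes and in
  its index sum. The third index is \<open>e - i - j\<close>, with -1 written as 2 modulo 3.\<close>

lemma transversal_through_two:
  fixes c d i j e :: nat
  assumes "c < 3" "d < 3" "c \<noteq> d" "i < 3" "j < 3" "e < 3"
  shows "\<exists>t. (\<forall>k<3. t k < 3) \<and> t c = i \<and> t d = j \<and> (t 0 + t 1 + t 2) mod 3 = e"
proof -
  define x where "x = (e + 2 * i + 2 * j) mod 3"
  define t where "t k = (if k = c then i else if k = d then j else x)" for k
  have "i = 0 \<or> i = 1 \<or> i = 2" "j = 0 \<or> j = 1 \<or> j = 2" "e = 0 \<or> e = 1 \<or> e = 2"
    using assms by auto
  then have "(i + j + x) mod 3 = e" unfolding x_def by (elim disjE) simp_all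
  moreover have "t 0 + t 1 + t 2 = i + j + x"
  proof -
    have "c = 0 \<or> c = 1 \<or> c = 2" "d = 0 \<or> d = 1 \<or> d = 2" using assms by auto
    then show ?thesis using assms(3) unfolding t_def by (elim disjE) simp_all
  qed
  moreover have "\<forall>k<3. t k < 3" using assms by (simp add: t_def x_def)
  moreover have "t c = i" "t d = j" using assms(3) by (auto simp: t_def)
  ultimately show ?thesis by auto
qed

lemma transversal_update:
  fixes t :: "nat \<Rightarrow> nat"
  assumes "\<forall>k<3. t k < 3" "c < 3" "i < 3"
    and "(t 0 + t 1 + t 2) mod 3 = 0" "((t(c := i)) 0 + (t(c := i)) 1 + (t(c := i)) 2) mod 3 = 0"
  shows "i = t c"
proof -
  have t: "t 0 = 0 \<or> t 0 = 1 \<or> t 0 = 2" "t 1 = 0 \<or> t 1 = 1 \<or> t 1 = 2" "t 2 = 0 \<or> t 2 = 1 \<or> t 2 = 2"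
    "i = 0 \<or> i = 1 \<or> i = 2" "c = 0 \<or> c = 1 \<or> c = 2"
    using assms(1-3) unfolding all_less_3 by auto
  show ?thesis using t(5)
  proof (elim disjE)
    assume c: "c = 0"
    show ?thesis using t(1-4) assms(4,5) unfolding c by (elim disjE) simp_all
  next
    assume c: "c = 1"
    show ?thesis using t(1-4) assms(4,5) unfolding c by (elim disjE) simp_all
  next
    assume c: "c = 2"
    show ?thesis using t(1-4) assms(4,5) unfolding c by (elim disjE) simp_all
  qed
qed

text \<open>A zero line would be concurrent with every pair of lines, and two proportional lines of
  different classes with every third line; both contradict a triple of index sum 1. Proportional
  lines of one class would give two triples of index sum 0 differing in one place. The net axiom
  holds because the meeting point of two lines from different classes lies on the triple of index
  sum 0 through them, and on no other line.\<close>

lemma standard_netI: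
  assumes det: "\<And>i j k. i < 3 \<Longrightarrow> j < 3 \<Longrightarrow> k < 3 \<Longrightarrow>
      det3 (M (0,i)) (M (1,j)) (M (2,k)) = 0 \<longleftrightarrow> (i + j + k) mod 3 = 0"
    and cls: "\<And>c. c < 3 \<Longrightarrow> det3 (M (c,0)) (M (c,1)) (M (c,2)) = 0 \<longleftrightarrow> c < n" and n: "n \<le> 3"
  shows "standard_net M n"
proof -
  have T: "(\<exists>p. p \<noteq> (0,0,0) \<and> (\<forall>c<3. incid p (M (c, t c)))) \<longleftrightarrow> (t 0 + t 1 + t 2) mod 3 = 0"
    if "\<forall>c<3. t c < 3" for t
  proof -
    have "t 0 < 3" "t 1 < 3" "t 2 < 3" using that by simp_all
    from det[OF this] show ?thesis by (simp only: all_less_3 det3_eq_0_iff_common_point)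
  qed
  have nonzero: "M a \<noteq> (0,0,0)" if a: "a \<in> idx" for a
  proof
    assume z: "M a = (0,0,0)"
    obtain c i where e: "a = (c,i)" by (cases a)
    have lt: "c < 3" "i < 3" using a e by auto
    define d where "d = (c + 1) mod 3"
    define f where "f = (c + 2) mod 3"
    have c: "c = 0 \<or> c = 1 \<or> c = 2" using lt by auto
    have d: "d < 3" "d \<noteq> c" and cover: "\<And>k. k < 3 \<Longrightarrow> k = c \<or> k = d \<or> k = f"
      using c by (auto simp: d_def f_def)
    obtain t where t: "\<forall>k<3. t k < 3" "t c = i" "(t 0 + t 1 + t 2) mod 3 = 1"
      using transversal_through_two[of c d i 0 1] lt d by auto
    obtain p where p: "p \<noteq> (0,0,0)" "incid p (M (d, t d))" "incid p (M (f, t f))"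
      using two_lines_meet by blast
    have "incid p (M (c, t c))" using z t(2) e by (simp add: incid_def split: prod.splits)
    then have "\<forall>k<3. incid p (M (k, t k))" using p(2,3) cover by blast
    then have "(t 0 + t 1 + t 2) mod 3 = 0" using T[OF t(1)] p(1) by blast
    then show False using t(3) by simp
  qed
  have nonprop: "M b \<noteq> smul3 s (M a)" if ab: "a \<in> idx" "b \<in> idx" "a \<noteq> b" for a b s
  proof
    assume eq: "M b = smul3 s (M a)"
    obtain c i where a: "a = (c,i)" by (cases a)
    obtain d j where b: "b = (d,j)" by (cases b)
    have lt: "c < 3" "i < 3" "d < 3" "j < 3" using ab a b by auto
    show False
    proof (cases "c = d")
      case True
      then have "i \<noteq> j" using ab(3) a b by simp
      obtain x where x: "x < 3" "x \<noteq> c" by (cases "c = 0") (use that[of 1] that[of 0] in auto)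
      obtain t where t: "\<forall>k<3. t k < 3" "t c = i" "(t 0 + t 1 + t 2) mod 3 = 0"
        using transversal_through_two[of c x i 0 0] lt x by auto
      obtain p where p: "p \<noteq> (0,0,0)" "\<forall>k<3. incid p (M (k, t k))"
        using iffD2[OF T[OF t(1)] t(3)] by blast
      then have "incid p (M a)" using lt(1) t(2) a by blast
      then have "incid p (M (c,j))" using eq b True incid_smul3_right by simp
      then have "\<forall>k<3. incid p (M (k, (t(c := j)) k))" using p(2) by simp
      moreover have "\<forall>k<3. (t(c := j)) k < 3" using t(1) lt(4) by simp
      ultimately have "((t(c := j)) 0 + (t(c := j)) 1 + (t(c := j)) 2) mod 3 = 0"
        using T p(1) by blast
      then have "j = t c" by (rule transversal_update[OF t(1) lt(1,4) t(3)])
      then show False using t(2) \<open>i \<noteq> j\<close> by simp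
    next
      case False
      obtain t where t: "\<forall>k<3. t k < 3" "t c = i" "t d = j" "(t 0 + t 1 + t 2) mod 3 = 1"
        using transversal_through_two[of c d i j 1] lt False by auto
      \<comment> \<open>The class indices 0, 1, 2 add up to 3, so this is the remaining
        class.\<close>
      define f where "f = 3 - c - d"
      have cover: "k = c \<or> k = d \<or> k = f" if "k < 3" for k
        using lt False that by (auto simp: f_def)
      obtain p where p: "p \<noteq> (0,0,0)" "incid p (M (c, t c))" "incid p (M (f, t f))"
        using two_lines_meet by blast
      have "incid p (M (d, t d))" using p(2) eq a b t(2,3) incid_smul3_right by simp
      then have "\<forall>k<3. incid p (M (k, t k))" using p(2,3) cover by blast
      then have "(t 0 + t 1 + t 2) mod 3 = 0" using T[OF t(1)] p(1) by blast
      then show False using t(4) by simp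
    qed
  qed
  have "net33 M"
    unfolding net33_def
  proof (intro conjI allI impI ballI)
    show "arrangement9 M" using nonzero nonprop unfolding arrangement9_def by blast
    fix p a b k
    assume p: "p \<noteq> (0,0,0)" and ab: "a \<in> idx" "b \<in> idx" and k: "k < (3::nat)"
      and inc: "fst a \<noteq> fst b \<and> incid p (M a) \<and> incid p (M b)"
    obtain c i where a: "a = (c,i)" by (cases a)
    obtain d j where b: "b = (d,j)" by (cases b)
    have lt: "c < 3" "i < 3" "d < 3" "j < 3" and cd: "c \<noteq> d" using ab a b inc by auto
    obtain t where t: "\<forall>k<3. t k < 3" "t c = i" "t d = j" "(t 0 + t 1 + t 2) mod 3 = 0"
      using transversal_through_two[of c d i j 0] lt cd by auto
    obtain q where q: "q \<noteq> (0,0,0)" "\<forall>k<3. incid q (M (k, t k))" using T[OF t(1)] t(4) by blast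
    have qab: "incid q (M a)" "incid q (M b)" using q(2) lt t(2,3) a b by blast+
    have "a \<noteq> b" using inc by blast
    then have cr: "cross3 (M a) (M b) \<noteq> (0,0,0)"
      using cross3_eq_0_imp_smul3 nonzero[OF ab(1)] nonprop[OF ab] by blast
    obtain u where u: "p = smul3 u (cross3 (M a) (M b))"
      using incid_both_imp_smul3_cross3[OF _ _ cr] inc by blast
    obtain v where v: "q = smul3 v (cross3 (M a) (M b))"
      using incid_both_imp_smul3_cross3[OF qab cr] by blast
    have uv: "u \<noteq> 0" "v \<noteq> 0" using p q(1) u v by (auto simp: smul3_zero_iff)
    \<comment> \<open>The given point \<open>p\<close> and the centre \<open>q\<close> of the triple
      are both the intersection of the two lines, so they are the same projective point.\<close>
    have pq: "incid p l \<longleftrightarrow> incid q l" for l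
      unfolding u v using uv by (simp add: incid_smul3_left)
    have "{j. j < 3 \<and> incid p (M (k,j))} = {t k}"
    proof (intro set_eqI iffI)
      fix l assume "l \<in> {t k}"
      then show "l \<in> {j. j < 3 \<and> incid p (M (k,j))}" using t(1) q(2) k pq by simp
    next
      fix l assume "l \<in> {j. j < 3 \<and> incid p (M (k,j))}"
      then have l: "l < 3" "incid q (M (k,l))" using pq by simp_all
      then have "\<forall>x<3. incid q (M (x, (t(k := l)) x))" using q(2) by simp
      moreover have "\<forall>x<3. (t(k := l)) x < 3" using t(1) l(1) by simp
      ultimately have "((t(k := l)) 0 + (t(k := l)) 1 + (t(k := l)) 2) mod 3 = 0"
        using T q(1) by blast
      then have "l = t k" by (rule transversal_update[OF t(1) k l(1) t(4)])
      then show "l \<in> {t k}" by simp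
    qed
    then show "card {j. j < 3 \<and> incid p (M (k,j))} = 1" by simp
  qed
  moreover have "concurrent_classes M = {..<n}"
  proof -
    have "concurrent M ({c} \<times> {0..<3}) \<longleftrightarrow> det3 (M (c,0)) (M (c,1)) (M (c,2)) = 0" for c
    proof -
      have "(\<forall>a\<in>{c} \<times> {0..<3}. incid p (M a)) \<longleftrightarrow> (\<forall>j<3. incid p (M (c,j)))" for p by auto
      then show ?thesis unfolding concurrent_def det3_eq_0_iff_common_point by (simp only: all_less_3)
    qed
    then show ?thesis unfolding concurrent_classes_def using cls n by auto
  qed
  moreover have "concurrent M {(0,i),(1,j),(2,k)} \<longleftrightarrow> (i + j + k) mod 3 = 0"
    if "i < 3" "j < 3" "k < 3" for i j k
    unfolding det[OF that, symmetric] det3_eq_0_iff_common_point concurrent_def by simp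
  ultimately show ?thesis unfolding standard_net_def by (intro conjI allI impI)
qed

section \<open>The Ceva, Hesse-type and one-parameter models\<close>

text \<open>The number \<open>h\<close> is half the square root of 3. Keeping only
  \<open>h * h = 3/4\<close> and \<open>h \<noteq> 0\<close> makes later determinants polynomial in
  \<open>h\<close> with rational coefficients.\<close>

lemma omega_power_cases:
  obtains h :: real where "h * h = 3/4" "h \<noteq> 0"
    "omega = Complex (-1/2) h" "omega ^ 2 = Complex (-1/2) (-h)"
proof (rule that[of "sqrt 3 / 2"])
  show om: "omega = Complex (-1/2) (sqrt 3 / 2)"
    using cos_120 sin_120 by (simp add: omega_def cis.code mult.commute)
  show "omega ^ 2 = Complex (-1/2) (- (sqrt 3 / 2))"
    unfolding om by (simp add: power2_eq_square complex_eq_iff)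
qed simp_all

lemma omega_power_eq_1_iff: "omega ^ n = 1 \<longleftrightarrow> n mod 3 = 0"
proof -
  obtain h :: real where h: "h * h = 3/4" "h \<noteq> 0"
    "omega = Complex (-1/2) h" "omega ^ 2 = Complex (-1/2) (-h)"
    using omega_power_cases .
  have "omega ^ 3 = omega ^ 2 * omega" by (simp add: numeral_eq_Suc)
  also have "\<dots> = 1" unfolding h(4) unfolding h(3) using h(1) by (simp add: complex_eq_iff)
  finally have 3: "omega ^ 3 = 1" .
  have "omega ^ n = omega ^ (3 * (n div 3) + n mod 3)" by simp
  also have "\<dots> = omega ^ (n mod 3)" by (simp only: power_add power_mult 3 power_one mult_1)
  finally have eq: "omega ^ n = omega ^ (n mod 3)" .
  have "n mod 3 = 0 \<or> n mod 3 = 1 \<or> n mod 3 = 2" by auto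
  then show ?thesis
    unfolding eq using h(2,4) by (elim disjE) (simp_all add: complex_eq_iff h(3))
qed

lemma ceva_standard: "standard_net ceva 3"
proof (rule standard_netI)
  fix i j k :: nat
  \<comment> \<open>Each row of this determinant has a 1 and one negated power of
    \<open>omega\<close> in cyclic position, so only two products survive. Inside a class one
    coordinate is constantly 0, hence every class is a pencil.\<close>
  have "det3 (ceva (0,i)) (ceva (1,j)) (ceva (2,k)) = 1 - omega ^ (i + j + k)"
    by (simp add: ceva_def det3_def dot3_def cross3_def power_add)
  then show "det3 (ceva (0,i)) (ceva (1,j)) (ceva (2,k)) = 0 \<longleftrightarrow> (i + j + k) mod 3 = 0"
    using omega_power_eq_1_iff[of "i + j + k"] by auto
next
  fix c :: nat
  assume "c < 3"
  then have "c = 0 \<or> c = 1 \<or> c = 2" by auto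
  then show "det3 (ceva (c,0)) (ceva (c,1)) (ceva (c,2)) = 0 \<longleftrightarrow> c < 3"
    by (elim disjE) (simp_all add: ceva_def det3_def dot3_def cross3_def)
qed simp

text \<open>The fibre of the Hesse pencil through the line \<open>x + \<omega>\<^sup>i y + \<omega>\<^sup>j z\<close> is determined by \<open>i + j\<close>
  modulo 3, so the classes of the net are not the rows of the indexing of \<open>hesse\<close>.\<close>

definition hesse_relabel :: "nat \<times> nat \<Rightarrow> nat \<times> nat" where
  "hesse_relabel = (\<lambda>(c,i). (2 * (c + i) mod 3, (i + 2 * c) mod 3))"

lemma bij_betw_hesse_relabel: "bij_betw hesse_relabel idx idx"
proof -
  have "{0..<3::nat} = {0,1,2}" by auto
  then have idx: "idx = {(0,0),(0,1),(0,2),(1,0),(1,1),(1,2),(2,0),(2,1),(2,2)}"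
    by (simp add: idx_def)
  have inj: "inj_on hesse_relabel idx"
    unfolding idx by (simp add: hesse_relabel_def)
  have "hesse_relabel ` idx \<subseteq> idx" by (auto simp: hesse_relabel_def)
  then have "hesse_relabel ` idx = idx" using inj by (intro endo_inj_surj) (simp_all add: idx_def)
  then show ?thesis using inj by (simp add: bij_betw_def)
qed

text \<open>The two components of \<open>hesse_relabel (c,i)\<close> add up to \<open>c\<close>
  modulo 3, so class \<open>c\<close> consists of the three lines of one singular fibre. Such a
  fibre is a triangle, which is why no class is concurrent.\<close>

lemma hesse_standard: "standard_net (hesse \<circ> hesse_relabel) 0"
proof (rule standard_netI)
  obtain h :: real where h: "h * h = 3/4" "h \<noteq> 0"
    "omega = Complex (-1/2) h" "omega ^ 2 = Complex (-1/2) (-h)"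
    using omega_power_cases .
  \<comment> \<open>Reduces squares of \<open>h\<close> that occur inside longer products.\<close>
  have h': "h * (h * x) = 3/4 * x" for x using h(1) by (simp flip: mult.assoc)
  {
    fix i j k :: nat
    assume "i < 3" "j < 3" "k < 3"
    then have "i = 0 \<or> i = 1 \<or> i = 2" "j = 0 \<or> j = 1 \<or> j = 2" "k = 0 \<or> k = 1 \<or> k = 2" by auto
    then show "det3 ((hesse \<circ> hesse_relabel) (0,i)) ((hesse \<circ> hesse_relabel) (1,j))
        ((hesse \<circ> hesse_relabel) (2,k)) = 0 \<longleftrightarrow> (i + j + k) mod 3 = 0"
      unfolding hesse_def hesse_relabel_def det3_def dot3_def cross3_def o_def
      by (elim disjE)
        (simp_all add: h(2,4) complex_eq_iff, simp_all add: h complex_eq_iff algebra_simps h')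
  next
    fix c :: nat
    assume "c < 3"
    then have "c = 0 \<or> c = 1 \<or> c = 2" by auto
    then show "det3 ((hesse \<circ> hesse_relabel) (c,0)) ((hesse \<circ> hesse_relabel) (c,1))
        ((hesse \<circ> hesse_relabel) (c,2)) = 0 \<longleftrightarrow> c < 0"
      unfolding hesse_def hesse_relabel_def det3_def dot3_def cross3_def o_def
      by (elim disjE)
        (simp_all add: h(2,4) complex_eq_iff, simp_all add: h complex_eq_iff algebra_simps h')
  }
qed simp

text \<open>In \<open>fam b\<close> the second class is the concurrent one, its middle line being
  the sum of the other two, so it is exchanged with the first. A mixed triple of the family has as
  its third index the sum of the other two modulo 3; doubling negates that index.\<close>

definition fam_relabel :: "nat \<times> nat \<Rightarrow> nat \<times> nat" where
  "fam_relabel = relabel (\<lambda>c. if c = 2 then 2 else 1 - c) (\<lambda>c i. if c = 2 then 2 * i mod 3 else i)"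

lemma bij_betw_fam_relabel: "bij_betw fam_relabel idx idx"
  unfolding fam_relabel_def
proof (rule bij_betw_relabel)
  show "bij_betw (\<lambda>c. if c = 2 then 2 else 1 - c) {..<3} {..<3::nat}"
    by (intro bij_betw_imageI endo_inj_surj) (auto simp: inj_on_def)
  have "{..<3::nat} = {0,1,2}" by auto
  then have surj: "(\<lambda>i. 2 * i mod 3) ` {..<3} = {..<3::nat}" by auto
  then have "bij_betw (\<lambda>i. 2 * i mod 3) {..<3} {..<3::nat}"
    by (simp add: bij_betw_def eq_card_imp_inj_on)
  then show "bij_betw (\<lambda>i. if c = 2 then 2 * i mod 3 else i) {..<3} {..<3::nat}" for c :: nat
    using bij_betw_id[of "{..<3::nat}"] by (cases "c = 2") (simp_all add: id_def)
qed

text \<open>Each of the other two classes of \<open>fam b\<close> is concurrent exactly when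
  \<open>b^2 - b + 1\<close> is 0, a factor of \<open>b^3 + 1\<close>. At \<open>b = 2\<close> this
  value is 3, and all coefficients are rational.\<close>

lemma fam_2_standard: "standard_net (fam 2 \<circ> fam_relabel) 1"
proof (rule standard_netI)
  fix i j k :: nat
  assume "i < 3" "j < 3" "k < 3"
  then have "i = 0 \<or> i = 1 \<or> i = 2" "j = 0 \<or> j = 1 \<or> j = 2" "k = 0 \<or> k = 1 \<or> k = 2" by auto
  then show "det3 ((fam 2 \<circ> fam_relabel) (0,i)) ((fam 2 \<circ> fam_relabel) (1,j))
      ((fam 2 \<circ> fam_relabel) (2,k)) = 0 \<longleftrightarrow> (i + j + k) mod 3 = 0"
    unfolding fam_def fam_relabel_def relabel_def det3_def dot3_def cross3_def o_def
    by (elim disjE) simp_all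
next
  fix c :: nat
  assume "c < 3"
  then have "c = 0 \<or> c = 1 \<or> c = 2" by auto
  then show "det3 ((fam 2 \<circ> fam_relabel) (c,0)) ((fam 2 \<circ> fam_relabel) (c,1))
      ((fam 2 \<circ> fam_relabel) (c,2)) = 0 \<longleftrightarrow> c < 1"
    unfolding fam_def fam_relabel_def relabel_def det3_def dot3_def cross3_def o_def
    by (elim disjE) simp_all
qed simp

section \<open>The three cases and the classification\<close>

text \<open>A net has 9 triple points plus one for each concurrent class, so the number of triple
  points alone recovers the number of concurrent classes. The same reading serves the other two
  cases and makes the cases exclusive.\<close>

lemma case1_iff:
  assumes "net33 L"
  shows "case1 L \<longleftrightarrow> card (concurrent_classes L) = 3"
proof
  assume "case1 L"
  then show "card (concurrent_classes L) = 3"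
    using card_mpoints_3[OF assms] by (simp add: case1_def)
next
  assume n: "card (concurrent_classes L) = 3"
  have "concurrent_classes L \<subseteq> {..<3}" by (auto simp: concurrent_classes_def)
  then have cc: "concurrent_classes L = {..<3}" using n by (intro card_subset_eq) simp_all
  have "mpoints L 2 = {}" using card_mpoints_2[OF assms] n by simp
  moreover have "card (mpoints L 3) = 12" using card_mpoints_3[OF assms] n by simp
  moreover have "\<forall>i<3. card (class_triple_points L i) = 1"
    using class_triple_points_card(1)[OF assms] cc by simp
  moreover have "lattice_iso L ceva"
  proof -
    obtain \<sigma> where "bij_betw \<sigma> idx idx" "standard_net (L \<circ> \<sigma>) 3"
      using net33_standardize[OF assms, unfolded n] .
    then show ?thesis
      using lattice_iso_if_standard[of L \<sigma> 3 ceva id] ceva_standard by simp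
  qed
  ultimately show "case1 L" by (simp add: case1_def)
qed

lemma case2_iff:
  assumes "net33 L"
  shows "case2 L \<longleftrightarrow> card (concurrent_classes L) = 0"
proof
  assume "case2 L"
  then show "card (concurrent_classes L) = 0"
    using card_mpoints_3[OF assms] by (simp add: case2_def)
next
  assume n: "card (concurrent_classes L) = 0"
  have "card (mpoints L 2) = 9" using card_mpoints_2[OF assms] n by simp
  moreover have "card (mpoints L 3) = 9" using card_mpoints_3[OF assms] n by simp
  moreover have "nonmixed_triple_points L = {}"
    using nonmixed_triple_points_finite_card[OF assms] n by simp
  moreover have "lattice_iso L hesse"
  proof -
    obtain \<sigma> where "bij_betw \<sigma> idx idx" "standard_net (L \<circ> \<sigma>) 0"
      using net33_standardize[OF assms, unfolded n] .
    then show ?thesis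
      using lattice_iso_if_standard hesse_standard bij_betw_hesse_relabel by blast
  qed
  ultimately show "case2 L" by (simp add: case2_def)
qed

lemma case3_iff:
  assumes "net33 L"
  shows "case3 L \<longleftrightarrow> card (concurrent_classes L) = 1"
proof
  assume "case3 L"
  then show "card (concurrent_classes L) = 1"
    using card_mpoints_3[OF assms] by (simp add: case3_def)
next
  assume n: "card (concurrent_classes L) = 1"
  then obtain d where d: "concurrent_classes L = {d}" by (auto simp: card_1_singleton_iff)
  then have "d < 3" by (auto simp: concurrent_classes_def)
  then have "card (class_triple_points L d) = 1 \<and>
      (\<forall>i'<3. i' \<noteq> d \<longrightarrow> class_triple_points L i' = {})"
    using class_triple_points_card[OF assms] d by simp
  then have "\<exists>i<3. card (class_triple_points L i) = 1 \<and>
      (\<forall>i'<3. i' \<noteq> i \<longrightarrow> class_triple_points L i' = {})" using \<open>d < 3\<close> by blast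
  moreover have "card (mpoints L 2) = 6" using card_mpoints_2[OF assms] n by simp
  moreover have "card (mpoints L 3) = 10" using card_mpoints_3[OF assms] n by simp
  moreover have "\<exists>b. b \<noteq> 0 \<and> b \<noteq> 1 \<and> b ^ 3 \<noteq> -1 \<and> lattice_iso L (fam b)"
  proof -
    obtain \<sigma> where "bij_betw \<sigma> idx idx" "standard_net (L \<circ> \<sigma>) 1"
      using net33_standardize[OF assms, unfolded n] .
    then have "lattice_iso L (fam 2)"
      using lattice_iso_if_standard fam_2_standard bij_betw_fam_relabel by blast
    \<comment> \<open>The parameter need not depend on \<open>L\<close>, since only the lattice is
      compared; 2 is admissible because its cube is 8.\<close>
    then show ?thesis by (intro exI[of _ 2]) simp
  qed
  ultimately show "case3 L" by (simp add: case3_def)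
qed

theorem theorem2p2:
  fixes L :: "nat \<times> nat \<Rightarrow> cvec"
  assumes "net33 L"
  shows "(\<forall>p. p \<noteq> (0,0,0) \<and> mult L p \<ge> 2 \<longrightarrow> mult L p = 2 \<or> mult L p = 3)
    \<and> card (mixed_points L) = 9
    \<and> (\<forall>p. p \<noteq> (0,0,0) \<and> mixed L p \<longrightarrow> mult L p = 3)
    \<and> (\<forall>p. p \<noteq> (0,0,0) \<and> mult L p = 3 \<and> \<not> mixed L p \<longrightarrow>
          (\<exists>i<3. lines_through L p = {i} \<times> {0..<3}))
    \<and> finite (nonmixed_triple_points L)
    \<and> card (nonmixed_triple_points L) \<in> {0, 1, 3}
    \<and> card (mpoints L 3) \<noteq> 11
    \<and> (case1 L \<or> case2 L \<or> case3 L)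
    \<and> \<not> (case1 L \<and> case2 L) \<and> \<not> (case1 L \<and> case3 L) \<and> \<not> (case2 L \<and> case3 L)
    \<and> (\<exists>M. net33 M \<and> case1 M) \<and> (\<exists>M. net33 M \<and> case2 M) \<and> (\<exists>M. net33 M \<and> case3 M)"
proof (intro conjI)
  note cls = card_concurrent_classes[OF assms]
  note iffs = case1_iff case2_iff case3_iff
  show "\<forall>p. p \<noteq> (0,0,0) \<and> mult L p \<ge> 2 \<longrightarrow> mult L p = 2 \<or> mult L p = 3"
  proof (intro allI impI)
    fix p assume "p \<noteq> (0,0,0) \<and> mult L p \<ge> 2"
    then show "mult L p = 2 \<or> mult L p = 3" using mult_le_3[OF assms, of p] by linarith
  qed
  show "card (mixed_points L) = 9" by (rule card_mixed_points[OF assms])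
  show "\<forall>p. p \<noteq> (0,0,0) \<and> mixed L p \<longrightarrow> mult L p = 3" using mult_mixed[OF assms] by blast
  show "\<forall>p. p \<noteq> (0,0,0) \<and> mult L p = 3 \<and> \<not> mixed L p \<longrightarrow>
      (\<exists>i<3. lines_through L p = {i} \<times> {0..<3})"
    using mult_nonmixed_eq_3_iff[OF assms] by blast
  show "finite (nonmixed_triple_points L)" "card (nonmixed_triple_points L) \<in> {0, 1, 3}"
    using nonmixed_triple_points_finite_card[OF assms] cls by simp_all
  \<comment> \<open>Eleven triple points would mean exactly two concurrent classes.\<close>
  show "card (mpoints L 3) \<noteq> 11" using card_mpoints_3[OF assms] cls by auto
  show "case1 L \<or> case2 L \<or> case3 L" using cls iffs[OF assms] by auto
  show "\<not> (case1 L \<and> case2 L)" "\<not> (case1 L \<and> case3 L)" "\<not> (case2 L \<and> case3 L)"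
    using iffs[OF assms] by auto
  have example: "net33 M \<and> card (concurrent_classes M) = n" if "standard_net M n" for M n
    using that by (simp add: standard_net_def)
  \<comment> \<open>The models are themselves the examples, the last two in their relabelled form,
    where the index rows are the classes of the net.\<close>
  show "\<exists>M. net33 M \<and> case1 M" using example[OF ceva_standard] case1_iff by blast
  show "\<exists>M. net33 M \<and> case2 M" using example[OF hesse_standard] case2_iff by blast
  show "\<exists>M. net33 M \<and> case3 M" using example[OF fam_2_standard] case3_iff by blast
qed

end
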